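(* Let $A$ be a nonzero finite-dimensional complex algebra, equipped with a compatible orthogonal fixed embedding system, with integral coefficient ring $\mathcal{R}(A)$. Suppose that there are integers $k,s\ge0$ and polynomials $p_0(z),\dots,p_k(z)\in\mathbb{C}[z]$ with $p_k\neq0$, and let $L=\sum_{j=0}^kx^jp_j\big(x\frac{d}{dx}\big)$, such that one of the following conditions is satisfied: (1) for every nonzero finite-dimensional left $A$-module $M$, $R_M(x):=L\,\Phi^{\mathrm{emb}}(P_M^\bullet;x)\in\mathcal{R}(A)[x]$ and $\deg_xR_M(x)\le s$; (2) for every nonzero finite-dimensional left $A$-module $M$, $R_M^{\mathrm{lin}}(x):=L\,\Phi^{\mathrm{lin}}(P_M^\bullet;x)\in\mathcal{R}(A)[x]$ and $\deg_xR^{\mathrm{lin}}_M(x)\le s$. (Here $k,s,p_0,\dots,p_k$ are independent of $M$.) Then \[ \mathrm{fin.dim}\,A\le\max\big(\{0,s-k\}\cup\{n\in\mathbb{Z}_{\ge0}:p_k(n)=0\}\big)<\infty. \]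
   Context: $\mathrm{fin.dim}\,A=\sup\{\mathrm{proj.dim}_AM: M \text{ finite-dimensional left } A\text{-module},\ \mathrm{proj.dim}_AM<\infty\}$. Fix a basis $\{a_1,\dots,a_d\}$ of $A$. For a finite-dimensional left $A$-module $M$ let $\rho_M:A\to\mathrm{End}_{\mathbb{C}}(M)$ be the structure map. For $t\in(\mathbb{R}_{\ge0})^d$, $I_A(t)=\{\sum_i\lambda_ia_i:0\le\lambda_i\le t_i\}\cong\prod_i[0,t_i]$ carries the transported $d$-dimensional Lebesgue measure $\mu_t$. The integral profile of $M$ is $\Phi_M:(\mathbb{R}_{\ge0})^d\to\mathrm{End}_{\mathbb{C}}(M)$, $\Phi_M(t)=\int_{I_A(t)}\rho_M(x)\,d\mu_t(x)$ (Bochner integral). Let $\mathcal{C}_A=\mathrm{add}(\mathrm{proj}\cup\mathrm{inj})$ be the category of finite direct sums of finite-dimensional projective and injective left $A$-modules, and $\Pi=\bigoplus_v(P(v)\oplus I(v))$, where $P(v)$ and $I(v)$ run over representatives of the isomorphism classes of indecomposable projective, resp. injective, left modules. A fixed embedding system is a choice, for every $M\in\mathcal{C}_A$, of a left $A$-module $M'$ and an $A$-isomorphism $\sigma_M:\Pi^{\oplus\mathbb{N}}\to M\oplus M'$. For $f:(\mathbb{R}_{\ge0})^d\to\mathrm{End}_{\mathbb{C}}(M)$ put $\mathrm{Emb}_M(f)(t)=\sigma_M^{-1}\circ\iota_M\circ f(t)\circ\pi_M\circ\sigma_M$, with $\pi_M,\iota_M$ the canonical projection $M\oplus M'\to M$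 and inclusion $M\to M\oplus M'$. $\mathcal{R}(A)$ is the (non-unital) complex subalgebra of $\mathrm{Map}((\mathbb{R}_{\ge0})^d,\mathrm{End}_{\mathbb{C}}(\Pi^{\oplus\mathbb{N}}))$ (pointwise operations) generated by all $\mathrm{Emb}_M(\Phi_M)$, $M\in\mathcal{C}_A$. The system is compatible orthogonal if, with $X$ running over representatives of the isomorphism classes of indecomposable modules in $\mathcal{C}_A$, there are submodules $X^{(r)}\cong X$ ($r\ge1$) of $\Pi^{\oplus\mathbb{N}}$ giving an internal direct sum decomposition $\Pi^{\oplus\mathbb{N}}=\bigoplus_X\bigoplus_{r\ge1}X^{(r)}$, such that whenever $M\cong\bigoplus_XX^{\oplus m_X}$, $\sigma_M$ identifies $\bigoplus_X\bigoplus_{1\le r\le m_X}X^{(r)}$ with $M$ and the sum of all remaining copies with $M'$. Then $F_{X,r}:(\mathbb{R}_{\ge0})^d\to\mathrm{End}_{\mathbb{C}}(\Pi^{\oplus\mathbb{N}})$ denotes the map with $F_{X,r}(t)$ equal to $\Phi_{X^{(r)}}(t)$ on $X^{(r)}$ and to zero on all other copies; it lies in $\mathcal{R}(A)$. For $M$ with minimal projective resolution $\cdots\to P_M^1\to P_M^0\to M\to0$, put $\Phi^{\mathrm{emb}}(P_M^\bullet;x)=\sum_{n\ge0}\mathrm{Emb}_{P_M^n}(\Phi_{P_M^n})x^n\in\mathcal{R}(A)[[x]]$. Let $Q_1,\dots,Q_r$ be representatives of the indecomposable projective left $A$-modules; for a finitely generated projective $P\cong\bigoplus_iQ_i^{\oplus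 m_i(P)}$ put $\Phi^{\mathrm{lin}}_P=\sum_im_i(P)F_{Q_i,1}\in\mathcal{R}(A)$, and $\Phi^{\mathrm{lin}}(P_M^\bullet;x)=\sum_{n\ge0}\Phi^{\mathrm{lin}}_{P_M^n}x^n$. The operator $x\frac{d}{dx}$ acts on $\mathcal{R}(A)[[x]]$ by $\sum C_nx^n\mapsto\sum nC_nx^n$, so $x^jp(x\frac{d}{dx})(C_nx^n)=p(n)C_nx^{n+j}$. Convention: $\deg_x0=-\infty$. *)

theory Defs
  imports
    "HOL-Analysis.Analysis"
    "HOL-Computational_Algebra.Formal_Power_Series"
    "HOL-Library.Function_Algebras"
begin

section \<open>Complex algebras\<close>

text \<open>A nonzero associative unital complex algebra; it is nonzero because \<^class>\<open>ring_1\<close>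
  contains \<open>0 \<noteq> 1\<close>.\<close>

class complex_algebra_1 = ring_1 +
  fixes scaleC :: "complex \<Rightarrow> 'a \<Rightarrow> 'a" (infixr \<open>*\<^sub>C\<close> 75)
  assumes scaleC_right_distrib: "c *\<^sub>C (x + y) = c *\<^sub>C x + c *\<^sub>C y"
    and scaleC_left_distrib: "(b + c) *\<^sub>C x = b *\<^sub>C x + c *\<^sub>C x"
    and scaleC_scaleC: "b *\<^sub>C c *\<^sub>C x = (b * c) *\<^sub>C x"
    and scaleC_one: "1 *\<^sub>C x = x"
    and mult_scaleC_left: "(c *\<^sub>C x) * y = c *\<^sub>C (x * y)"
    and mult_scaleC_right: "x * (c *\<^sub>C y) = c *\<^sub>C (x * y)"

global_interpretation cvs: vector_space "scaleC :: complex \<Rightarrow> 'a \<Rightarrow> 'a::complex_algebra_1"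
  by unfold_locales
    (simp_all add: scaleC_right_distrib scaleC_left_distrib scaleC_scaleC scaleC_one)

text \<open>Finite-dimensionality of the algebra is expressed by the existence of a basis indexed by
  the finite type \<open>'d\<close>.\<close>

definition algebra_basis :: "('d::finite \<Rightarrow> 'a::complex_algebra_1) \<Rightarrow> bool" where
  "algebra_basis a \<longleftrightarrow>
     inj a \<and> cvs.independent (range a) \<and> cvs.span (range a) = UNIV"


section \<open>Left modules\<close>

text \<open>A module consists of an additive subgroup \<open>car\<close> of the ambient group \<open>'v\<close> and an action of
  the algebra on it; the values of \<open>act\<close> outside \<open>car\<close> are irrelevant. The complex structure is
  the one induced by the action of \<open>c *\<^sub>C 1\<close>.\<close>

record ('a, 'v) lmodule =
  car :: "'v set"
  act :: "'a \<Rightarrow> 'v \<Rightarrow> 'v"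

definition left_module :: "('a::complex_algebra_1, 'v::ab_group_add) lmodule \<Rightarrow> bool" where
  "left_module M \<longleftrightarrow>
     0 \<in> car M \<and>
     (\<forall>x\<in>car M. \<forall>y\<in>car M. x + y \<in> car M) \<and>
     (\<forall>x\<in>car M. - x \<in> car M) \<and>
     (\<forall>r. \<forall>x\<in>car M. act M r x \<in> car M) \<and>
     (\<forall>r. \<forall>x\<in>car M. \<forall>y\<in>car M. act M r (x + y) = act M r x + act M r y) \<and>
     (\<forall>r q. \<forall>x\<in>car M. act M (r + q) x = act M r x + act M q x) \<and>
     (\<forall>r q. \<forall>x\<in>car M. act M (r * q) x = act M r (act M q x)) \<and>
     (\<forall>x\<in>car M. act M 1 x = x)"

definition cscale :: "('a::complex_algebra_1, 'v) lmodule \<Rightarrow> complex \<Rightarrow> 'v \<Rightarrow> 'v" where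
  "cscale M c x = act M (c *\<^sub>C 1) x"

definition is_coords ::
  "('a::complex_algebra_1, 'v::ab_group_add) lmodule \<Rightarrow> 'v set \<Rightarrow> 'v \<Rightarrow> ('v \<Rightarrow> complex) \<Rightarrow> bool" where
  "is_coords M B x c \<longleftrightarrow> (\<forall>b. b \<notin> B \<longrightarrow> c b = 0) \<and> x = (\<Sum>b\<in>B. cscale M (c b) b)"

definition finite_cbasis ::
  "('a::complex_algebra_1, 'v::ab_group_add) lmodule \<Rightarrow> 'v set \<Rightarrow> bool" where
  "finite_cbasis M B \<longleftrightarrow> finite B \<and> B \<subseteq> car M \<and> (\<forall>x\<in>car M. \<exists>!c. is_coords M B x c)"

definition coords ::
  "('a::complex_algebra_1, 'v::ab_group_add) lmodule \<Rightarrow> 'v set \<Rightarrow> 'v \<Rightarrow> 'v \<Rightarrow> complex" where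
  "coords M B x = (THE c. is_coords M B x c)"

definition fd_module :: "('a::complex_algebra_1, 'v::ab_group_add) lmodule \<Rightarrow> bool" where
  "fd_module M \<longleftrightarrow> left_module M \<and> (\<exists>B. finite_cbasis M B)"

definition module_hom ::
  "('a, 'v::ab_group_add) lmodule \<Rightarrow> ('a, 'w::ab_group_add) lmodule \<Rightarrow> ('v \<Rightarrow> 'w) set" where
  "module_hom M N = {f. (\<forall>x\<in>car M. f x \<in> car N) \<and>
     (\<forall>x\<in>car M. \<forall>y\<in>car M. f (x + y) = f x + f y) \<and>
     (\<forall>r. \<forall>x\<in>car M. f (act M r x) = act N r (f x))}"

definition module_iso ::
  "('a, 'v::ab_group_add) lmodule \<Rightarrow> ('a, 'w::ab_group_add) lmodule \<Rightarrow> ('v \<Rightarrow> 'w) set" where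
  "module_iso M N = {f \<in> module_hom M N. bij_betw f (car M) (car N)}"

definition isomorphic ::
  "('a, 'v::ab_group_add) lmodule \<Rightarrow> ('a, 'w::ab_group_add) lmodule \<Rightarrow> bool" where
  "isomorphic M N \<longleftrightarrow> module_iso M N \<noteq> {}"

definition submodule :: "('a, 'v::ab_group_add) lmodule \<Rightarrow> 'v set \<Rightarrow> bool" where
  "submodule M N \<longleftrightarrow> N \<subseteq> car M \<and> 0 \<in> N \<and> (\<forall>x\<in>N. \<forall>y\<in>N. x + y \<in> N) \<and>
     (\<forall>x\<in>N. - x \<in> N) \<and> (\<forall>r. \<forall>x\<in>N. act M r x \<in> N)"

definition kernel ::
  "('a, 'v::ab_group_add) lmodule \<Rightarrow> ('v \<Rightarrow> 'w::ab_group_add) \<Rightarrow> 'v set" where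
  "kernel M f = {x \<in> car M. f x = 0}"

definition dsum2 ::
  "('a, 'v::ab_group_add) lmodule \<Rightarrow> ('a, 'w::ab_group_add) lmodule \<Rightarrow> ('a, 'v \<times> 'w) lmodule" where
  "dsum2 M N = \<lparr>car = car M \<times> car N, act = (\<lambda>r (x, y). (act M r x, act N r y))\<rparr>"

definition dsum ::
  "'i set \<Rightarrow> ('i \<Rightarrow> ('a, 'v::ab_group_add) lmodule) \<Rightarrow> ('a, 'i \<Rightarrow> 'v) lmodule" where
  "dsum J M = \<lparr>car = {x. (\<forall>i\<in>J. x i \<in> car (M i)) \<and> (\<forall>i. i \<notin> J \<longrightarrow> x i = 0) \<and> finite {i. x i \<noteq> 0}},
               act = (\<lambda>r x i. if i \<in> J then act (M i) r (x i) else 0)\<rparr>"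

definition indecomposable :: "('a, 'v::ab_group_add) lmodule \<Rightarrow> bool" where
  "indecomposable M \<longleftrightarrow> car M \<noteq> {0} \<and>
     (\<forall>N N'. submodule M N \<and> submodule M N' \<and> N \<inter> N' = {0} \<and>
        {x + y | x y. x \<in> N \<and> y \<in> N'} = car M \<longrightarrow> N = {0} \<or> N' = {0})"

definition is_decomposition ::
  "'j set \<Rightarrow> ('j \<Rightarrow> 'w::ab_group_add set) \<Rightarrow> 'w \<Rightarrow> ('j \<Rightarrow> 'w) \<Rightarrow> bool" where
  "is_decomposition J C w x \<longleftrightarrow> (\<forall>j\<in>J. x j \<in> C j) \<and> (\<forall>j. j \<notin> J \<longrightarrow> x j = 0) \<and>
     finite {j. x j \<noteq> 0} \<and> w = (\<Sum>j | x j \<noteq> 0. x j)"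

definition internal_sum :: "'j set \<Rightarrow> ('j \<Rightarrow> 'w::ab_group_add set) \<Rightarrow> 'w set" where
  "internal_sum J C = {w. \<exists>x. is_decomposition J C w x}"

definition internal_direct_sum ::
  "('a, 'w::ab_group_add) lmodule \<Rightarrow> 'j set \<Rightarrow> ('j \<Rightarrow> 'w set) \<Rightarrow> bool" where
  "internal_direct_sum V J C \<longleftrightarrow> (\<forall>j\<in>J. submodule V (C j)) \<and> internal_sum J C = car V \<and>
     (\<forall>w\<in>car V. \<exists>!x. is_decomposition J C w x)"

definition component :: "'j set \<Rightarrow> ('j \<Rightarrow> 'w::ab_group_add set) \<Rightarrow> 'w \<Rightarrow> 'j \<Rightarrow> 'w" where
  "component J C w = (THE x. is_decomposition J C w x)"


section \<open>The universe of modules; homological notions\<close>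

text \<open>Modules are taken with carriers in the additive group \<open>nat \<Rightarrow> complex\<close>. As a rational vector
  space it has the dimension of the continuum, so every module of at most continuum cardinality is
  isomorphic to one of this form: in particular every finite- or countable-dimensional one, and
  enough free modules to cover all of these. Hence the lifting properties below, although they
  quantify over this universe only, are the usual ones.\<close>

type_synonym univ = "nat \<Rightarrow> complex"
type_synonym 'a amod = "('a, univ) lmodule"

definition projective :: "'a::complex_algebra_1 amod \<Rightarrow> bool" where
  "projective P \<longleftrightarrow> left_module P \<and>
     (\<forall>(N :: 'a amod) (N' :: 'a amod) g f.
        left_module N \<and> left_module N' \<and> g \<in> module_hom N N' \<and> g ` car N = car N' \<and>
        f \<in> module_hom P N' \<longrightarrow>
        (\<exists>h\<in>module_hom P N. \<forall>x\<in>car P. g (h x) = f x))"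

definition injective :: "'a::complex_algebra_1 amod \<Rightarrow> bool" where
  "injective E \<longleftrightarrow> left_module E \<and>
     (\<forall>(N :: 'a amod) (N' :: 'a amod) g f.
        left_module N \<and> left_module N' \<and> g \<in> module_hom N N' \<and> inj_on g (car N) \<and>
        f \<in> module_hom N E \<longrightarrow>
        (\<exists>h\<in>module_hom N' E. \<forall>x\<in>car N. h (g x) = f x))"

text \<open>\<open>d n\<close> is the differential from \<open>P (n + 1)\<close> to \<open>P n\<close>, and \<open>e\<close> the augmentation from \<open>P 0\<close>
  to \<open>M\<close>.\<close>

definition projective_resolution ::
  "'a::complex_algebra_1 amod \<Rightarrow> (nat \<Rightarrow> 'a amod) \<Rightarrow> (nat \<Rightarrow> univ \<Rightarrow> univ) \<Rightarrow> (univ \<Rightarrow> univ) \<Rightarrow> bool"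
  where
  "projective_resolution M P d e \<longleftrightarrow>
     (\<forall>n. projective (P n)) \<and>
     e \<in> module_hom (P 0) M \<and> (\<forall>n. d n \<in> module_hom (P (Suc n)) (P n)) \<and>
     e ` car (P 0) = car M \<and>
     d 0 ` car (P 1) = kernel (P 0) e \<and>
     (\<forall>n. d (Suc n) ` car (P (Suc (Suc n))) = kernel (P (Suc n)) (d n))"

definition superfluous :: "('a, 'v::ab_group_add) lmodule \<Rightarrow> 'v set \<Rightarrow> bool" where
  "superfluous M K \<longleftrightarrow>
     (\<forall>N. submodule M N \<and> {x + y | x y. x \<in> N \<and> y \<in> K} = car M \<longrightarrow> N = car M)"

text \<open>Minimality: the augmentation and all differentials are projective covers of their images,
  that is, their kernels are superfluous.\<close>

definition minimal_projective_resolution ::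
  "'a::complex_algebra_1 amod \<Rightarrow> (nat \<Rightarrow> 'a amod) \<Rightarrow> (nat \<Rightarrow> univ \<Rightarrow> univ) \<Rightarrow> (univ \<Rightarrow> univ) \<Rightarrow> bool"
  where
  "minimal_projective_resolution M P d e \<longleftrightarrow>
     projective_resolution M P d e \<and> (\<forall>n. fd_module (P n)) \<and>
     superfluous (P 0) (kernel (P 0) e) \<and>
     (\<forall>n. superfluous (P (Suc n)) (kernel (P (Suc n)) (d n)))"

text \<open>The infimum of the empty set is \<open>\<infinity>\<close>; the zero module gets projective dimension \<open>0\<close>, which
  does not affect the supremum \<open>findim\<close>.\<close>

definition proj_dim :: "'a::complex_algebra_1 amod \<Rightarrow> enat" where
  "proj_dim M = Inf {enat n | n.
     \<exists>P d e. projective_resolution M P d e \<and> (\<forall>i>n. car (P i) = {0})}"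

definition findim :: "'a::complex_algebra_1 itself \<Rightarrow> enat" where
  "findim _ = Sup {proj_dim M | M :: 'a amod. fd_module M \<and> proj_dim M < \<infinity>}"


section \<open>Integral profiles\<close>

typedef ('d::finite) orthant = "{t :: real ^ 'd. \<forall>i. 0 \<le> t $ i}"
  morphisms vec_of orthant_of
  by (rule exI[of _ 0]) simp

definition lincomb :: "('d::finite \<Rightarrow> 'a::complex_algebra_1) \<Rightarrow> real ^ 'd \<Rightarrow> 'a" where
  "lincomb a l = (\<Sum>i\<in>UNIV. complex_of_real (l $ i) *\<^sub>C a i)"

text \<open>Lebesgue measure on the box \<open>\<Prod>i. {0..t\<^sub>i}\<close>, transported to the space
  \<open>I\<^sub>A(t) = lincomb a ` cbox 0 t\<close>.\<close>

definition box_measure :: "('d::finite \<Rightarrow> 'a::complex_algebra_1) \<Rightarrow> 'd orthant \<Rightarrow> 'a measure" where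
  "box_measure a t = embed_measure (lebesgue_on (cbox 0 (vec_of t))) (lincomb a)"

text \<open>The Bochner integral of the structure map in the finite-dimensional space of complex
  endomorphisms of \<open>M\<close>: this space is identified with a space of complex matrices by a basis \<open>B\<close>
  of \<open>M\<close> (the result does not depend on \<open>B\<close>), and the matrix entries are integrated. As
  everywhere below, endomorphisms are extended by zero outside the carrier, so that equality of
  endomorphisms is equality of functions.\<close>

definition profile ::
  "('d::finite \<Rightarrow> 'a::complex_algebra_1) \<Rightarrow> ('a, 'v::ab_group_add) lmodule \<Rightarrow> 'd orthant \<Rightarrow> 'v \<Rightarrow> 'v"
  where
  "profile a M t x =
     (let B = (SOME B. finite_cbasis M B);
          entry = (\<lambda>b b'. LINT r | box_measure a t. coords M B (act M r b') b)
      in if x \<in> car M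
         then \<Sum>b'\<in>B. \<Sum>b\<in>B. cscale M (coords M B x b' * entry b b') b
         else 0)"


section \<open>Embedding systems and the integral coefficient ring\<close>

definition in_CA :: "'a::complex_algebra_1 amod \<Rightarrow> bool" where
  "in_CA M \<longleftrightarrow> fd_module M \<and>
     (\<exists>(n::nat) N. (\<forall>i<n. fd_module (N i) \<and> (projective (N i) \<or> injective (N i))) \<and>
        isomorphic M (dsum {..<n} N))"

definition representatives ::
  "('a::complex_algebra_1 amod \<Rightarrow> bool) \<Rightarrow> 'i set \<Rightarrow> ('i \<Rightarrow> 'a amod) \<Rightarrow> bool" where
  "representatives S J Y \<longleftrightarrow>
     (\<forall>j\<in>J. S (Y j)) \<and> (\<forall>M. S M \<longrightarrow> (\<exists>!j. j \<in> J \<and> isomorphic M (Y j)))"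

text \<open>\<open>PiN P E\<close> is the sum of countably many copies of \<open>\<Oplus>\<^sub>v (P(v) \<oplus> E(v))\<close>.\<close>

type_synonym 'v pin = "nat \<Rightarrow> 'v \<Rightarrow> univ \<times> univ"

definition PiN ::
  "('v::finite \<Rightarrow> 'a::complex_algebra_1 amod) \<Rightarrow> ('v \<Rightarrow> 'a amod) \<Rightarrow> ('a, 'v pin) lmodule" where
  "PiN P E = dsum UNIV (\<lambda>_. dsum UNIV (\<lambda>v. dsum2 (P v) (E v)))"

definition fixed_embedding_system ::
  "('v::finite \<Rightarrow> 'a::complex_algebra_1 amod) \<Rightarrow> ('v \<Rightarrow> 'a amod) \<Rightarrow>
   ('a amod \<Rightarrow> 'a amod) \<Rightarrow> ('a amod \<Rightarrow> 'v pin \<Rightarrow> univ \<times> univ) \<Rightarrow> bool" where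
  "fixed_embedding_system P E M' \<sigma> \<longleftrightarrow>
     representatives (\<lambda>M. fd_module M \<and> indecomposable M \<and> projective M) UNIV P \<and>
     representatives (\<lambda>M. fd_module M \<and> indecomposable M \<and> injective M) UNIV E \<and>
     (\<forall>M. in_CA M \<longrightarrow> left_module (M' M) \<and> \<sigma> M \<in> module_iso (PiN P E) (dsum2 M (M' M)))"

definition Emb ::
  "('v::finite \<Rightarrow> 'a::complex_algebra_1 amod) \<Rightarrow> ('v \<Rightarrow> 'a amod) \<Rightarrow>
   ('a amod \<Rightarrow> 'v pin \<Rightarrow> univ \<times> univ) \<Rightarrow> 'a amod \<Rightarrow>
   ('d::finite orthant \<Rightarrow> univ \<Rightarrow> univ) \<Rightarrow> 'd orthant \<Rightarrow> 'v pin \<Rightarrow> 'v pin" where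
  "Emb P E \<sigma> M f t w =
     (if w \<in> car (PiN P E)
      then inv_into (car (PiN P E)) (\<sigma> M) (f t (fst (\<sigma> M w)), 0)
      else 0)"

definition map_scale ::
  "('a::complex_algebra_1, 'w) lmodule \<Rightarrow> complex \<Rightarrow> ('t \<Rightarrow> 'w \<Rightarrow> 'w) \<Rightarrow> 't \<Rightarrow> 'w \<Rightarrow> 'w" where
  "map_scale V c f = (\<lambda>t w. cscale V c (f t w))"

inductive_set coeff_ring ::
  "('d::finite \<Rightarrow> 'a::complex_algebra_1) \<Rightarrow> ('v::finite \<Rightarrow> 'a amod) \<Rightarrow> ('v \<Rightarrow> 'a amod) \<Rightarrow>
   ('a amod \<Rightarrow> 'v pin \<Rightarrow> univ \<times> univ) \<Rightarrow> ('d orthant \<Rightarrow> 'v pin \<Rightarrow> 'v pin) set"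
  for a P E \<sigma> where
  generator: "in_CA M \<Longrightarrow> Emb P E \<sigma> M (profile a M) \<in> coeff_ring a P E \<sigma>"
| zero: "0 \<in> coeff_ring a P E \<sigma>"
| add: "f \<in> coeff_ring a P E \<sigma> \<Longrightarrow> g \<in> coeff_ring a P E \<sigma> \<Longrightarrow> f + g \<in> coeff_ring a P E \<sigma>"
| scale: "f \<in> coeff_ring a P E \<sigma> \<Longrightarrow> map_scale (PiN P E) c f \<in> coeff_ring a P E \<sigma>"
| mult: "f \<in> coeff_ring a P E \<sigma> \<Longrightarrow> g \<in> coeff_ring a P E \<sigma> \<Longrightarrow>
    (\<lambda>t. f t \<circ> g t) \<in> coeff_ring a P E \<sigma>"

text \<open>\<open>copies X m\<close> indexes the summands of \<open>\<Oplus>\<^sub>X X\<^bsup>m\<^sub>X\<^esup>\<close>, with \<open>X\<close> ranging over \<open>\<X>\<close>.\<close>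

definition copies :: "'x set \<Rightarrow> ('x \<Rightarrow> nat) \<Rightarrow> ('x \<times> nat) set" where
  "copies \<X> m = {(X, r). X \<in> \<X> \<and> 1 \<le> r \<and> r \<le> m X}"

definition all_copies :: "'x set \<Rightarrow> ('x \<times> nat) set" where
  "all_copies \<X> = {(X, r). X \<in> \<X> \<and> 1 \<le> r}"

text \<open>\<open>C (X, r)\<close> is the submodule \<open>X\<^bsup>(r)\<^esup>\<close>.\<close>

definition compatible_orthogonal ::
  "('v::finite \<Rightarrow> 'a::complex_algebra_1 amod) \<Rightarrow> ('v \<Rightarrow> 'a amod) \<Rightarrow>
   ('a amod \<Rightarrow> 'a amod) \<Rightarrow> ('a amod \<Rightarrow> 'v pin \<Rightarrow> univ \<times> univ) \<Rightarrow>
   'a amod set \<Rightarrow> ('a amod \<times> nat \<Rightarrow> 'v pin set) \<Rightarrow> bool" where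
  "compatible_orthogonal P E M' \<sigma> \<X> C \<longleftrightarrow>
     representatives (\<lambda>M. in_CA M \<and> indecomposable M) \<X> (\<lambda>X. X) \<and>
     internal_direct_sum (PiN P E) (all_copies \<X>) C \<and>
     (\<forall>(X, r) \<in> all_copies \<X>. isomorphic X ((PiN P E)\<lparr>car := C (X, r)\<rparr>)) \<and>
     (\<forall>M m. in_CA M \<and> isomorphic M (dsum (copies \<X> m) fst) \<longrightarrow>
        \<sigma> M ` internal_sum (copies \<X> m) C = car M \<times> {0} \<and>
        \<sigma> M ` internal_sum (all_copies \<X> - copies \<X> m) C = {0} \<times> car (M' M))"

definition copy_profile ::
  "('d::finite \<Rightarrow> 'a::complex_algebra_1) \<Rightarrow> ('v::finite \<Rightarrow> 'a amod) \<Rightarrow> ('v \<Rightarrow> 'a amod) \<Rightarrow>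
   'a amod set \<Rightarrow> ('a amod \<times> nat \<Rightarrow> 'v pin set) \<Rightarrow> 'a amod \<Rightarrow> nat \<Rightarrow>
   'd orthant \<Rightarrow> 'v pin \<Rightarrow> 'v pin" where
  "copy_profile a P E \<X> C X r t w =
     (if w \<in> car (PiN P E)
      then profile a ((PiN P E)\<lparr>car := C (X, r)\<rparr>) t (component (all_copies \<X>) C w (X, r))
      else 0)"

text \<open>The members of \<open>{X \<in> \<X>. projective X}\<close> serve as the representatives \<open>Q\<^sub>i\<close> of the
  indecomposable projective modules.\<close>

definition proj_mult :: "'a::complex_algebra_1 amod set \<Rightarrow> 'a amod \<Rightarrow> 'a amod \<Rightarrow> nat" where
  "proj_mult \<X> P = (SOME m. (\<forall>X. X \<notin> {X \<in> \<X>. projective X} \<longrightarrow> m X = 0) \<and>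
     isomorphic P (dsum (copies {X \<in> \<X>. projective X} m) fst))"

definition lin_profile ::
  "('d::finite \<Rightarrow> 'a::complex_algebra_1) \<Rightarrow> ('v::finite \<Rightarrow> 'a amod) \<Rightarrow> ('v \<Rightarrow> 'a amod) \<Rightarrow>
   'a amod set \<Rightarrow> ('a amod \<times> nat \<Rightarrow> 'v pin set) \<Rightarrow> 'a amod \<Rightarrow>
   'd orthant \<Rightarrow> 'v pin \<Rightarrow> 'v pin" where
  "lin_profile a P E \<X> C N =
     (\<Sum>Q | Q \<in> \<X> \<and> projective Q.
        map_scale (PiN P E) (of_nat (proj_mult \<X> N Q)) (copy_profile a P E \<X> C Q 1))"


section \<open>Generating series and differential operators\<close>

text \<open>\<open>R\<close> being a set of coefficients, \<open>poly_over R\<close> is \<open>R[x]\<close> inside the power series.\<close>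

definition poly_over :: "'r::zero set \<Rightarrow> 'r fps set" where
  "poly_over R = {F. (\<forall>n. fps_nth F n \<in> R) \<and> finite {n. fps_nth F n \<noteq> 0}}"

text \<open>The supremum of the empty set is \<open>- \<infinity>\<close>.\<close>

definition deg_x :: "'r::zero fps \<Rightarrow> ereal" where
  "deg_x F = Sup {ereal (real n) | n. fps_nth F n \<noteq> 0}"

definition emb_series ::
  "('d::finite \<Rightarrow> 'a::complex_algebra_1) \<Rightarrow> ('v::finite \<Rightarrow> 'a amod) \<Rightarrow> ('v \<Rightarrow> 'a amod) \<Rightarrow>
   ('a amod \<Rightarrow> 'v pin \<Rightarrow> univ \<times> univ) \<Rightarrow> (nat \<Rightarrow> 'a amod) \<Rightarrow>
   ('d orthant \<Rightarrow> 'v pin \<Rightarrow> 'v pin) fps" where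
  "emb_series a P E \<sigma> N = Abs_fps (\<lambda>n. Emb P E \<sigma> (N n) (profile a (N n)))"

definition lin_series ::
  "('d::finite \<Rightarrow> 'a::complex_algebra_1) \<Rightarrow> ('v::finite \<Rightarrow> 'a amod) \<Rightarrow> ('v \<Rightarrow> 'a amod) \<Rightarrow>
   'a amod set \<Rightarrow> ('a amod \<times> nat \<Rightarrow> 'v pin set) \<Rightarrow> (nat \<Rightarrow> 'a amod) \<Rightarrow>
   ('d orthant \<Rightarrow> 'v pin \<Rightarrow> 'v pin) fps" where
  "lin_series a P E \<X> C N = Abs_fps (\<lambda>n. lin_profile a P E \<X> C (N n))"

text \<open>Operators on power series over a space whose scalar multiplication is \<open>sc\<close>:
  \<open>x d/dx\<close>, a polynomial \<open>p(x d/dx)\<close> in it, multiplication by \<open>x\<^bsup>j\<^esup>\<close>, and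
  \<open>\<Sum>j\<le>k. x\<^bsup>j\<^esup> p\<^sub>j(x d/dx)\<close>.\<close>

definition euler_op :: "(complex \<Rightarrow> 'r \<Rightarrow> 'r) \<Rightarrow> 'r::comm_monoid_add fps \<Rightarrow> 'r fps" where
  "euler_op sc F = Abs_fps (\<lambda>n. sc (of_nat n) (fps_nth F n))"

definition poly_euler_op ::
  "(complex \<Rightarrow> 'r \<Rightarrow> 'r) \<Rightarrow> complex poly \<Rightarrow> 'r::comm_monoid_add fps \<Rightarrow> 'r fps" where
  "poly_euler_op sc p F =
     (\<Sum>i\<le>degree p. Abs_fps (\<lambda>n. sc (coeff p i) (fps_nth ((euler_op sc ^^ i) F) n)))"

definition x_shift :: "nat \<Rightarrow> 'r::comm_monoid_add fps \<Rightarrow> 'r fps" where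
  "x_shift j F = Abs_fps (\<lambda>n. if n < j then 0 else fps_nth F (n - j))"

definition diff_op ::
  "(complex \<Rightarrow> 'r \<Rightarrow> 'r) \<Rightarrow> nat \<Rightarrow> (nat \<Rightarrow> complex poly) \<Rightarrow> 'r::comm_monoid_add fps \<Rightarrow> 'r fps" where
  "diff_op sc k p F = (\<Sum>j\<le>k. x_shift j (poly_euler_op sc (p j) F))"

end

theory Submission
  imports Defs
begin

text \<open>
  The proof reads off one coefficient. Let \<open>M\<close> have finite projective dimension \<open>m > 0\<close> and minimal
  resolution \<open>N\<close>, and let \<open>c n\<close> be the \<open>n\<close>-th coefficient of its generating series. Since \<open>c n = 0\<close>
  for \<open>n > m\<close>, the only summand of \<open>L\<close> that contributes to the coefficient of \<open>x\<^sup>m\<^sup>+\<^sup>k\<close> is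
  \<open>x\<^sup>k p\<^sub>k(x d/dx)\<close>, and that coefficient is \<open>p\<^sub>k(m) c m\<close>. If \<open>m + k > s\<close>, it vanishes by the degree
  hypothesis, and then \<open>c m \<noteq> 0\<close> forces \<open>p\<^sub>k(m) = 0\<close>. Hence \<open>m \<le> s - k\<close> or \<open>m\<close> is one of the finitely
  many roots of \<open>p\<^sub>k\<close>; this is \<open>diff_op_degree_bound\<close>. (For \<open>m = 0\<close> the
  bound holds because \<open>0\<close> is among the candidates for the maximum.) Two facts carry the argument.

  First, \<open>c n\<close> vanishes exactly when \<open>N n\<close> does. The reflection \<open>l \<mapsto> t - l\<close> of the box computes
  the profile: it is half the volume of the box times the action of \<open>\<Sum>i. t\<^sub>i a\<^sub>i\<close> (\<open>profile_eq\<close>). If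
  these operators killed a vector \<open>x\<close> for all \<open>t\<close> with positive coordinates, then so would every
  \<open>a\<^sub>i\<close> and hence \<open>1\<close>. An embedding \<open>\<sigma>\<^sub>M\<close> loses nothing of this (\<open>Emb_profile_eq_0_iff\<close>). In the
  linearised series the summands for distinct indecomposable projectives live on independent
  submodules, so they cannot cancel, and a nonzero projective module has at least one indecomposable
  summand (\<open>lin_profile_eq_0_iff\<close>, resting on \<open>projective_decomposition\<close>).

  Second, minimal resolutions exist and end exactly in degree the projective dimension
  (\<open>exists_minimal_projective_resolution\<close>, \<open>minimal_resolution_top\<close>). A projective cover is obtained
  as a surjection from a projective module of least dimension. For the length, a minimal
  resolution \<open>N\<close> is compared with an arbitrary one \<open>P\<close>: the composite \<open>N \<rightarrow> P \<rightarrow> N\<close> of chain maps over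
  the identity is onto in each degree because all syzygies in \<open>N\<close> are superfluous, so \<open>N n = 0\<close> as
  soon as \<open>P n = 0\<close>.
\<close>

section \<open>Modules, homomorphisms and submodules\<close>

lemma
  assumes "left_module M"
  shows zero_in_car: "0 \<in> car M"
    and add_in_car: "x \<in> car M \<Longrightarrow> y \<in> car M \<Longrightarrow> x + y \<in> car M"
    and minus_in_car: "x \<in> car M \<Longrightarrow> - x \<in> car M"
    and act_in_car: "x \<in> car M \<Longrightarrow> act M r x \<in> car M"
    and act_add_right: "x \<in> car M \<Longrightarrow> y \<in> car M \<Longrightarrow> act M r (x + y) = act M r x + act M r y"
    and act_add_left: "x \<in> car M \<Longrightarrow> act M (r + q) x = act M r x + act M q x"
    and act_mult: "x \<in> car M \<Longrightarrow> act M (r * q) x = act M r (act M q x)"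
    and act_one: "x \<in> car M \<Longrightarrow> act M 1 x = x"
  using assms unfolding left_module_def by blast+

lemma diff_in_car: "left_module M \<Longrightarrow> x \<in> car M \<Longrightarrow> y \<in> car M \<Longrightarrow> x - y \<in> car M"
  using add_in_car[of M x "- y"] minus_in_car[of M y] by simp

lemma act_zero_right: "left_module M \<Longrightarrow> act M r 0 = 0"
  using act_add_right[of M 0 0 r] zero_in_car[of M] by simp

lemma act_zero_left: "left_module M \<Longrightarrow> x \<in> car M \<Longrightarrow> act M 0 x = 0"
  using act_add_left[of M x 0 0] by simp

lemma act_minus_right: "left_module M \<Longrightarrow> x \<in> car M \<Longrightarrow> act M r (- x) = - act M r x"
  using act_add_right[of M x "- x" r] minus_in_car[of M x] act_zero_right[of M r]
  by (simp add: eq_neg_iff_add_eq_0 add.commute)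

lemma sum_in_car:
  "left_module M \<Longrightarrow> (\<And>i. i \<in> J \<Longrightarrow> f i \<in> car M) \<Longrightarrow> sum f J \<in> car M"
  by (induction J rule: infinite_finite_induct) (auto simp: zero_in_car add_in_car)

lemma act_sum_right:
  "left_module M \<Longrightarrow> (\<And>i. i \<in> J \<Longrightarrow> f i \<in> car M) \<Longrightarrow> act M r (sum f J) = (\<Sum>i\<in>J. act M r (f i))"
  by (induction J rule: infinite_finite_induct)
    (auto simp: act_zero_right act_add_right sum_in_car)

lemma act_sum_left:
  "left_module M \<Longrightarrow> x \<in> car M \<Longrightarrow> act M (sum f J) x = (\<Sum>i\<in>J. act M (f i) x)"
  by (induction J rule: infinite_finite_induct) (auto simp: act_zero_left act_add_left)

lemma
  assumes "left_module M"
  shows cscale_in_car: "x \<in> car M \<Longrightarrow> cscale M c x \<in> car M"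
    and cscale_add_right:
      "x \<in> car M \<Longrightarrow> y \<in> car M \<Longrightarrow> cscale M c (x + y) = cscale M c x + cscale M c y"
    and cscale_add_left: "x \<in> car M \<Longrightarrow> cscale M (b + c) x = cscale M b x + cscale M c x"
    and cscale_cscale: "x \<in> car M \<Longrightarrow> cscale M b (cscale M c x) = cscale M (b * c) x"
    and cscale_one: "x \<in> car M \<Longrightarrow> cscale M 1 x = x"
    and cscale_zero_left: "x \<in> car M \<Longrightarrow> cscale M 0 x = 0"
    and cscale_zero_right: "cscale M c 0 = 0"
    and act_scaleC: "x \<in> car M \<Longrightarrow> act M (c *\<^sub>C r) x = cscale M c (act M r x)"
    and act_cscale: "x \<in> car M \<Longrightarrow> act M r (cscale M c x) = cscale M c (act M r x)"
  using act_mult[OF assms, symmetric]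
  by (auto simp: cscale_def act_in_car[OF assms] act_add_right[OF assms] act_add_left[OF assms]
      scaleC_left_distrib mult_scaleC_left mult_scaleC_right scaleC_scaleC scaleC_one mult.commute
      act_one[OF assms] act_zero_right[OF assms] act_zero_left[OF assms] assms)

lemma cscale_sum_right:
  "left_module M \<Longrightarrow> (\<And>i. i \<in> J \<Longrightarrow> f i \<in> car M) \<Longrightarrow>
     cscale M c (sum f J) = (\<Sum>i\<in>J. cscale M c (f i))"
  unfolding cscale_def by (rule act_sum_right)

lemma cscale_sum_left:
  "left_module M \<Longrightarrow> x \<in> car M \<Longrightarrow> cscale M (sum f J) x = (\<Sum>i\<in>J. cscale M (f i) x)"
  by (induction J rule: infinite_finite_induct) (auto simp: cscale_zero_left cscale_add_left)

lemma cscale_minus_left: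
  "left_module M \<Longrightarrow> x \<in> car M \<Longrightarrow> cscale M (- c) x = - cscale M c x"
  using cscale_add_left[of M x "- c" c] cscale_zero_left[of M x]
  by (simp add: eq_neg_iff_add_eq_0)

lemma cscale_eq_0_iff:
  assumes M: "left_module M" and x: "x \<in> car M"
  shows "cscale M c x = 0 \<longleftrightarrow> c = 0 \<or> x = 0"
proof -
  have "x = 0" if "cscale M c x = 0" "c \<noteq> 0"
    using cscale_cscale[OF M x, of "1 / c" c] that cscale_zero_right[OF M] cscale_one[OF M x] by simp
  thus ?thesis using cscale_zero_left[OF M x] cscale_zero_right[OF M] by auto
qed

lemma
  assumes "f \<in> module_hom M N"
  shows hom_in_car: "x \<in> car M \<Longrightarrow> f x \<in> car N"
    and hom_add: "x \<in> car M \<Longrightarrow> y \<in> car M \<Longrightarrow> f (x + y) = f x + f y"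
    and hom_act: "x \<in> car M \<Longrightarrow> f (act M r x) = act N r (f x)"
  using assms unfolding module_hom_def by auto

lemma hom_cscale: "f \<in> module_hom M N \<Longrightarrow> x \<in> car M \<Longrightarrow> f (cscale M c x) = cscale N c (f x)"
  unfolding cscale_def by (rule hom_act)

lemma hom_zero: "left_module M \<Longrightarrow> f \<in> module_hom M N \<Longrightarrow> f 0 = 0"
  using hom_add[of f M N 0 0] zero_in_car[of M] by simp

lemma hom_minus: "left_module M \<Longrightarrow> f \<in> module_hom M N \<Longrightarrow> x \<in> car M \<Longrightarrow> f (- x) = - f x"
  using hom_add[of f M N x "- x"] minus_in_car[of M x] hom_zero[of M f N]
  by (simp add: eq_neg_iff_add_eq_0 add.commute)

lemma hom_diff:
  "left_module M \<Longrightarrow> f \<in> module_hom M N \<Longrightarrow> x \<in> car M \<Longrightarrow> y \<in> car M \<Longrightarrow> f (x - y) = f x - f y"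
  using hom_add[of f M N x "- y"] hom_minus[of M f N y] minus_in_car[of M y] by simp

lemma hom_sum:
  "left_module M \<Longrightarrow> f \<in> module_hom M N \<Longrightarrow> (\<And>i. i \<in> J \<Longrightarrow> g i \<in> car M) \<Longrightarrow>
     f (sum g J) = (\<Sum>i\<in>J. f (g i))"
  by (induction J rule: infinite_finite_induct) (auto simp: hom_zero hom_add sum_in_car)

lemma hom_compose:
  "f \<in> module_hom M N \<Longrightarrow> g \<in> module_hom N Q \<Longrightarrow> (\<lambda>x. g (f x)) \<in> module_hom M Q"
  unfolding module_hom_def by auto

lemma hom_inj_onI:
  assumes "left_module M" "f \<in> module_hom M N" "\<And>x. x \<in> car M \<Longrightarrow> f x = 0 \<Longrightarrow> x = 0"
  shows "inj_on f (car M)"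
proof (rule inj_onI)
  fix x y assume "x \<in> car M" "y \<in> car M" "f x = f y"
  hence "x - y = 0"
    using hom_diff[OF assms(1,2)] diff_in_car[OF assms(1)] by (intro assms(3)) auto
  thus "x = y" by simp
qed

lemma iso_inverse:
  assumes M: "left_module M" and f: "f \<in> module_iso M N"
  shows "inv_into (car M) f \<in> module_iso N M"
proof -
  have h: "f \<in> module_hom M N" and b: "bij_betw f (car M) (car N)"
    using f by (auto simp: module_iso_def)
  let ?g = "inv_into (car M) f"
  have inj: "inj_on f (car M)" using b by (rule bij_betw_imp_inj_on)
  have gin: "?g y \<in> car M" and fg: "f (?g y) = y" if "y \<in> car N" for y
    using that b by (auto simp: bij_betw_def f_inv_into_f inv_into_into)
  have "?g (x + y) = ?g x + ?g y" if "x \<in> car N" "y \<in> car N" for x y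
    using that gin fg
    by (intro inv_into_f_eq[OF inj]) (auto simp: add_in_car[OF M] hom_add[OF h])
  moreover have "?g (act N r x) = act M r (?g x)" if "x \<in> car N" for x r
    using that gin fg
    by (intro inv_into_f_eq[OF inj]) (auto simp: act_in_car[OF M] hom_act[OF h])
  ultimately show ?thesis
    using gin bij_betw_inv_into[OF b] by (auto simp: module_iso_def module_hom_def)
qed

lemma submodule_left_module:
  assumes "left_module M" "submodule M N"
  shows "left_module (M\<lparr>car := N\<rparr>)"
  using assms unfolding left_module_def submodule_def by (simp add: subset_iff)

lemma kernel_submodule:
  assumes M: "left_module M" and f: "f \<in> module_hom M N" and N: "left_module N"
  shows "submodule M (kernel M f)"
  unfolding submodule_def kernel_def
  using zero_in_car[OF M] add_in_car[OF M] minus_in_car[OF M] act_in_car[OF M]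
    hom_zero[OF M f] hom_add[OF f] hom_minus[OF M f] hom_act[OF f] act_zero_right[OF N]
  by auto

lemma image_submodule:
  assumes M: "left_module M" and f: "f \<in> module_hom M N"
  shows "submodule N (f ` car M)"
proof -
  have "0 \<in> f ` car M"
    using hom_zero[OF M f] zero_in_car[OF M] by (metis imageI)
  moreover have "x + y \<in> f ` car M" if "x \<in> f ` car M" "y \<in> f ` car M" for x y
    using that add_in_car[OF M] hom_add[OF f] by (auto simp: image_iff) metis
  moreover have "- x \<in> f ` car M" if "x \<in> f ` car M" for x
    using that minus_in_car[OF M] hom_minus[OF M f] by (auto simp: image_iff) metis
  moreover have "act N r x \<in> f ` car M" if "x \<in> f ` car M" for x r
    using that act_in_car[OF M] hom_act[OF f] by (auto simp: image_iff) metis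
  ultimately show ?thesis
    using hom_in_car[OF f] by (auto simp: submodule_def)
qed

lemma cscale_car_update [simp]: "cscale (M\<lparr>car := N\<rparr>) = cscale M"
  by (simp add: cscale_def fun_eq_iff)


section \<open>Dimension of finite-dimensional modules\<close>

definition lin_indep :: "('a::complex_algebra_1, 'v::ab_group_add) lmodule \<Rightarrow> 'v set \<Rightarrow> bool" where
  "lin_indep M I \<longleftrightarrow> finite I \<and> I \<subseteq> car M \<and>
     (\<forall>c. (\<Sum>b\<in>I. cscale M (c b) b) = 0 \<longrightarrow> (\<forall>b\<in>I. c b = 0))"

text \<open>Every module has its own carrier and scalar action, so linear algebra is imported by mapping
  the carrier linearly and injectively into a space \<open>'b \<Rightarrow> complex\<close>, where the scalars act
  pointwise; finite-dimensionality is finiteness of the common support \<open>T\<close>.\<close>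

definition coordinate_map ::
  "('a::complex_algebra_1, 'v::ab_group_add) lmodule \<Rightarrow> 'b set \<Rightarrow> ('v \<Rightarrow> 'b \<Rightarrow> complex) \<Rightarrow> bool" where
  "coordinate_map M T \<kappa> \<longleftrightarrow> finite T \<and>
     (\<forall>x\<in>car M. \<forall>y\<in>car M. \<kappa> (x + y) = \<kappa> x + \<kappa> y) \<and>
     (\<forall>c. \<forall>x\<in>car M. \<kappa> (cscale M c x) = (\<lambda>i. c * \<kappa> x i)) \<and>
     (\<forall>x\<in>car M. \<kappa> x = 0 \<longrightarrow> x = 0) \<and>
     (\<forall>x\<in>car M. \<forall>i. i \<notin> T \<longrightarrow> \<kappa> x i = 0)"

interpretation fun_vs: vector_space "\<lambda>(c::complex) (f::'b \<Rightarrow> complex) i. c * f i"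
  by unfold_locales (auto simp: fun_eq_iff algebra_simps)

lemma coordinate_map_sum:
  assumes M: "left_module M" and \<kappa>: "coordinate_map M T \<kappa>" and I: "I \<subseteq> car M"
  shows "\<kappa> (\<Sum>b\<in>I. cscale M (c b) b) = (\<Sum>b\<in>I. (\<lambda>i. c b * \<kappa> b i))"
  using I
proof (induction I rule: infinite_finite_induct)
  case (infinite I)
  have "\<kappa> 0 = \<kappa> 0 + \<kappa> 0"
    using \<kappa> zero_in_car[OF M] unfolding coordinate_map_def by (metis add_0)
  thus ?case using infinite by simp
next
  case empty
  have "\<kappa> 0 = \<kappa> 0 + \<kappa> 0"
    using \<kappa> zero_in_car[OF M] unfolding coordinate_map_def by (metis add_0)
  thus ?case by simp
next
  case (insert b I)
  have "cscale M (c b) b \<in> car M" "(\<Sum>b\<in>I. cscale M (c b) b) \<in> car M"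
    using insert.prems by (auto intro!: sum_in_car[OF M] cscale_in_car[OF M])
  thus ?case using insert \<kappa> unfolding coordinate_map_def by simp
qed

text \<open>A coordinate map sends \<open>I\<close> to an independent set in the span of the unit vectors of \<open>T\<close>, so
  this is the Steinitz bound of the function space.\<close>

lemma lin_indep_card_le:
  assumes M: "left_module M" and \<kappa>: "coordinate_map M T \<kappa>" and I: "lin_indep M I"
  shows "card I \<le> card T"
proof -
  have IM: "I \<subseteq> car M" and fI: "finite I" using I by (auto simp: lin_indep_def)
  have inj: "inj_on \<kappa> (car M)"
  proof (rule inj_onI)
    fix x y assume xy: "x \<in> car M" "y \<in> car M" "\<kappa> x = \<kappa> y"
    have d: "x - y \<in> car M" using diff_in_car[OF M] xy by blast
    have "\<kappa> (x - y + y) = \<kappa> (x - y) + \<kappa> y"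
      using \<kappa> d xy unfolding coordinate_map_def by blast
    hence "\<kappa> (x - y) = 0" using xy by simp
    thus "x = y" using \<kappa> d unfolding coordinate_map_def by auto
  qed
  have injI: "inj_on \<kappa> I" using inj_on_subset[OF inj IM] .
  let ?e = "\<lambda>t::'c. (\<lambda>i. if i = t then 1 else 0) :: 'c \<Rightarrow> complex"
  have sum_ap: "(\<Sum>t\<in>A. h t) i = (\<Sum>t\<in>A. h t i)" for A and h :: "'z \<Rightarrow> 'c \<Rightarrow> complex" and i
    by (induction A rule: infinite_finite_induct) auto
  have "fun_vs.independent (\<kappa> ` I)"
  proof
    assume "fun_vs.dependent (\<kappa> ` I)"
    then obtain u where u: "\<exists>v\<in>\<kappa> ` I. u v \<noteq> 0" "(\<Sum>v\<in>\<kappa> ` I. (\<lambda>i. u v * v i)) = 0"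
      using fun_vs.dependent_finite[of "\<kappa> ` I"] fI by auto
    have "\<kappa> (\<Sum>b\<in>I. cscale M (u (\<kappa> b)) b) = 0"
      using u(2) by (simp add: coordinate_map_sum[OF M \<kappa> IM] sum.reindex[OF injI] comp_def)
    moreover have "(\<Sum>b\<in>I. cscale M (u (\<kappa> b)) b) \<in> car M"
      using IM by (auto intro!: sum_in_car[OF M] cscale_in_car[OF M])
    ultimately have "(\<Sum>b\<in>I. cscale M (u (\<kappa> b)) b) = 0"
      using \<kappa> unfolding coordinate_map_def by blast
    hence "\<forall>b\<in>I. u (\<kappa> b) = 0"
      using I unfolding lin_indep_def by (elim conjE allE[of _ "\<lambda>b. u (\<kappa> b)"]) auto
    thus False using u(1) by auto
  qed
  moreover have "\<kappa> ` I \<subseteq> fun_vs.span (?e ` T)"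
  proof
    fix f assume "f \<in> \<kappa> ` I"
    hence supp: "f i = 0" if "i \<notin> T" for i
      using that \<kappa> IM unfolding coordinate_map_def by auto
    have fT: "finite T" using \<kappa> unfolding coordinate_map_def by auto
    have "f = (\<Sum>t\<in>T. (\<lambda>i. f t * ?e t i))"
      using supp fT by (auto simp: fun_eq_iff sum_ap if_distrib cong: if_cong)
    also have "\<dots> \<in> fun_vs.span (?e ` T)"
      by (intro fun_vs.span_sum fun_vs.span_scale fun_vs.span_base) auto
    finally show "f \<in> fun_vs.span (?e ` T)" .
  qed
  moreover have fT: "finite T" using \<kappa> unfolding coordinate_map_def by auto
  ultimately have "card (\<kappa> ` I) \<le> card (?e ` T)"
    using fun_vs.independent_span_bound[of "?e ` T" "\<kappa> ` I"] by simp
  also have "\<dots> \<le> card T" using fT by (rule card_image_le)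
  finally show ?thesis by (simp add: card_image[OF injI])
qed

lemma finite_cbasis_iff:
  assumes M: "left_module M"
  shows "finite_cbasis M B \<longleftrightarrow>
    lin_indep M B \<and> (\<forall>x\<in>car M. \<exists>c. x = (\<Sum>b\<in>B. cscale M (c b) b))" (is "_ \<longleftrightarrow> ?R")
proof
  assume B: "finite_cbasis M B"
  hence BM: "B \<subseteq> car M" and fB: "finite B" and ex1: "\<forall>x\<in>car M. \<exists>!c. is_coords M B x c"
    by (auto simp: finite_cbasis_def)
  have "\<forall>b\<in>B. c b = 0" if c: "(\<Sum>b\<in>B. cscale M (c b) b) = 0" for c
  proof -
    have "is_coords M B 0 (\<lambda>b. if b \<in> B then c b else 0)"
      using c by (auto simp: is_coords_def cong: sum.cong)
    moreover have "is_coords M B 0 (\<lambda>b. 0)"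
      using BM by (auto simp: is_coords_def cscale_zero_left[OF M] subset_iff)
    ultimately have "(\<lambda>b. if b \<in> B then c b else 0) = (\<lambda>b. 0)"
      using ex1 zero_in_car[OF M] by blast
    thus ?thesis by (metis)
  qed
  moreover have "\<forall>x\<in>car M. \<exists>c. x = (\<Sum>b\<in>B. cscale M (c b) b)"
    using ex1 unfolding is_coords_def by blast
  ultimately show ?R using BM fB by (auto simp: lin_indep_def)
next
  assume R: ?R
  hence BM: "B \<subseteq> car M" and fB: "finite B" by (auto simp: lin_indep_def)
  have "\<exists>!c. is_coords M B x c" if x: "x \<in> car M" for x
  proof (rule ex_ex1I)
    obtain c where "x = (\<Sum>b\<in>B. cscale M (c b) b)" using R x by blast
    hence "is_coords M B x (\<lambda>b. if b \<in> B then c b else 0)"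
      by (auto simp: is_coords_def cong: sum.cong)
    thus "\<exists>c. is_coords M B x c" by blast
  next
    fix c c' assume c: "is_coords M B x c" "is_coords M B x c'"
    have "cscale M (c b - c' b) b = cscale M (c b) b - cscale M (c' b) b" if "b \<in> B" for b
      using cscale_add_left[OF M, of b "c b" "- c' b"] cscale_minus_left[OF M, of b "c' b"] that BM
      by auto
    hence "(\<Sum>b\<in>B. cscale M (c b - c' b) b) = 0"
      using c by (simp add: is_coords_def sum_subtractf)
    hence "\<forall>b\<in>B. c b - c' b = 0"
      using R unfolding lin_indep_def by (elim conjE allE[of _ "\<lambda>b. c b - c' b"]) auto
    thus "c = c'" using c by (auto simp: is_coords_def fun_eq_iff)
  qed
  thus "finite_cbasis M B" using BM fB by (simp add: finite_cbasis_def)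
qed

lemma lin_indep_insert:
  assumes M: "left_module M" and I: "lin_indep M I" and x: "x \<in> car M" "x \<notin> I"
    and dep: "\<not> (\<exists>c. x = (\<Sum>b\<in>I. cscale M (c b) b))"
  shows "lin_indep M (insert x I)"
proof -
  have fI: "finite I" and IM: "I \<subseteq> car M" using I by (auto simp: lin_indep_def)
  have "\<forall>b\<in>insert x I. c b = 0" if c: "(\<Sum>b\<in>insert x I. cscale M (c b) b) = 0" for c
  proof -
    have eq: "cscale M (c x) x + (\<Sum>b\<in>I. cscale M (c b) b) = 0" using c x fI by simp
    have cx: "c x = 0"
    proof (rule ccontr)
      assume nz: "c x \<noteq> 0"
      have sM: "(\<Sum>b\<in>I. cscale M (c b) b) \<in> car M"
        using IM by (auto intro!: sum_in_car[OF M] cscale_in_car[OF M])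
      have "x = cscale M (1 / c x) (cscale M (c x) x)"
        using nz x by (simp add: cscale_cscale[OF M] cscale_one[OF M])
      also have "cscale M (c x) x = cscale M (-1) (\<Sum>b\<in>I. cscale M (c b) b)"
        using eq sM by (simp add: cscale_minus_left[OF M] cscale_one[OF M] eq_neg_iff_add_eq_0)
      also have "cscale M (1 / c x) \<dots> = (\<Sum>b\<in>I. cscale M (- (1 / c x) * c b) b)"
        using IM sM by (auto simp: cscale_cscale[OF M] cscale_sum_right[OF M] cscale_in_car[OF M]
            subset_iff intro!: sum.cong)
      finally show False using dep by (elim notE exI)
    qed
    hence "(\<Sum>b\<in>I. cscale M (c b) b) = 0" using eq x by (simp add: cscale_zero_left[OF M])
    thus ?thesis using I cx unfolding lin_indep_def by auto
  qed
  thus ?thesis using fI IM x by (simp add: lin_indep_def)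
qed

text \<open>A vector outside the span of \<open>I\<close> could be added to \<open>I\<close>.\<close>

lemma maximal_lin_indep_basis:
  assumes M: "left_module M" and I: "lin_indep M I"
    and max: "\<And>I'. lin_indep M I' \<Longrightarrow> card I' \<le> card I"
  shows "finite_cbasis M I"
proof -
  have fI: "finite I" and IM: "I \<subseteq> car M" using I by (auto simp: lin_indep_def)
  have "\<exists>c. x = (\<Sum>b\<in>I. cscale M (c b) b)" if x: "x \<in> car M" for x
  proof (cases "x \<in> I")
    case True
    have "(\<Sum>b\<in>I. cscale M (if b = x then 1 else 0) b) = (\<Sum>b\<in>I. if b = x then b else 0)"
      using IM by (intro sum.cong) (auto simp: cscale_one[OF M] cscale_zero_left[OF M] subset_iff)
    also have "\<dots> = x" using True fI by simp
    finally show ?thesis by (intro exI[of _ "\<lambda>b. if b = x then 1 else 0"]) simp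
  next
    case False
    show ?thesis
      using lin_indep_insert[OF M I x False] max[of "insert x I"] fI False by force
  qed
  thus ?thesis using I by (simp add: finite_cbasis_iff[OF M])
qed

text \<open>The sizes of independent sets are bounded by that of \<open>T\<close>, so a largest one exists. The criterion
  covers submodules, isomorphic copies and free modules alike.\<close>

lemma fd_moduleI:
  assumes M: "left_module M" and \<kappa>: "coordinate_map M T \<kappa>"
  shows "fd_module M"
proof -
  have "lin_indep M {}" by (simp add: lin_indep_def)
  moreover have "\<forall>I. lin_indep M I \<longrightarrow> card I < Suc (card T)"
    using lin_indep_card_le[OF M \<kappa>] by (simp add: less_Suc_eq_le)
  ultimately obtain I where "lin_indep M I" "\<forall>I'. lin_indep M I' \<longrightarrow> card I' \<le> card I"
    using ex_has_greatest_nat[of "lin_indep M" "{}" card "Suc (card T)"] by auto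
  thus ?thesis using maximal_lin_indep_basis[OF M] M by (auto simp: fd_module_def)
qed

lemma fd_left_module: "fd_module M \<Longrightarrow> left_module M"
  by (simp add: fd_module_def)

lemma is_coords_coords:
  "finite_cbasis M B \<Longrightarrow> x \<in> car M \<Longrightarrow> is_coords M B x (coords M B x)"
  unfolding finite_cbasis_def coords_def by (rule theI'[of "is_coords M B x"]) blast

lemma finite_cbasis_span:
  "finite_cbasis M B \<Longrightarrow> x \<in> car M \<Longrightarrow> \<exists>c. x = (\<Sum>b\<in>B. cscale M (c b) b)"
  using is_coords_coords[of M B x] unfolding is_coords_def by blast

lemma coords_eqI:
  "finite_cbasis M B \<Longrightarrow> x \<in> car M \<Longrightarrow> is_coords M B x c \<Longrightarrow> coords M B x = c"
  unfolding finite_cbasis_def coords_def by (rule the1_equality) auto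

lemma coordinate_map_coords:
  assumes M: "left_module M" and B: "finite_cbasis M B"
  shows "coordinate_map M B (coords M B)"
proof -
  have fB: "finite B" and BM: "B \<subseteq> car M" using B by (auto simp: finite_cbasis_def)
  note ic = is_coords_coords[OF B]
  have "coords M B (x + y) = coords M B x + coords M B y" if "x \<in> car M" "y \<in> car M" for x y
  proof (rule coords_eqI[OF B add_in_car[OF M that]])
    have "(\<Sum>b\<in>B. cscale M ((coords M B x + coords M B y) b) b) =
          (\<Sum>b\<in>B. cscale M (coords M B x b) b + cscale M (coords M B y b) b)"
      using BM by (intro sum.cong) (auto simp: cscale_add_left[OF M] subset_iff)
    thus "is_coords M B (x + y) (coords M B x + coords M B y)"
      using ic[OF that(1)] ic[OF that(2)] unfolding is_coords_def by (simp add: sum.distrib)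
  qed
  moreover have "coords M B (cscale M c x) = (\<lambda>i. c * coords M B x i)" if x: "x \<in> car M" for c x
  proof (rule coords_eqI[OF B cscale_in_car[OF M x]])
    have "(\<Sum>b\<in>B. cscale M (c * coords M B x b) b) =
          cscale M c (\<Sum>b\<in>B. cscale M (coords M B x b) b)"
      using BM by (auto simp: cscale_sum_right[OF M] cscale_in_car[OF M] cscale_cscale[OF M]
          subset_iff intro!: sum.cong)
    thus "is_coords M B (cscale M c x) (\<lambda>i. c * coords M B x i)"
      using ic[OF x] unfolding is_coords_def by simp
  qed
  moreover have "x = 0" if x: "x \<in> car M" "coords M B x = 0" for x
  proof -
    have "x = (\<Sum>b\<in>B. cscale M 0 b)" using ic[OF x(1)] x(2) by (simp add: is_coords_def)
    also have "\<dots> = 0" using BM by (intro sum.neutral) (auto simp: cscale_zero_left[OF M])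
    finally show ?thesis .
  qed
  moreover have "\<forall>x\<in>car M. \<forall>i. i \<notin> B \<longrightarrow> coords M B x i = 0"
    using ic by (auto simp: is_coords_def)
  ultimately show ?thesis using fB by (simp add: coordinate_map_def)
qed

definition cdim :: "('a::complex_algebra_1, 'v::ab_group_add) lmodule \<Rightarrow> nat" where
  "cdim M = card (SOME B. finite_cbasis M B)"

lemma cdim_eq_card:
  assumes M: "left_module M" and B: "finite_cbasis M B"
  shows "cdim M = card B"
proof -
  let ?B = "SOME B. finite_cbasis M B"
  have B': "finite_cbasis M ?B" using B by (rule someI)
  have "card ?B \<le> card B" "card B \<le> card ?B"
    using lin_indep_card_le[OF M coordinate_map_coords[OF M B]]
      lin_indep_card_le[OF M coordinate_map_coords[OF M B']] B B'
    by (auto simp: finite_cbasis_iff[OF M])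
  thus ?thesis by (simp add: cdim_def)
qed

lemma lin_indep_card_le_cdim:
  assumes M: "fd_module M" and I: "lin_indep M I"
  shows "card I \<le> cdim M"
proof -
  obtain B where B: "finite_cbasis M B" using M by (auto simp: fd_module_def)
  note lm = fd_left_module[OF M]
  show ?thesis
    using lin_indep_card_le[OF lm coordinate_map_coords[OF lm B] I] cdim_eq_card[OF lm B] by simp
qed

lemma lin_indep_card_eq_cdim:
  assumes M: "fd_module M" and I: "lin_indep M I" "card I = cdim M"
  shows "finite_cbasis M I"
  using maximal_lin_indep_basis[OF fd_left_module[OF M] I(1)] lin_indep_card_le_cdim[OF M] I(2)
  by simp

text \<open>The coordinates of the large module restrict to the submodule.\<close>

lemma fd_submodule:
  assumes M: "fd_module M" and N: "submodule M N"
  shows "fd_module (M\<lparr>car := N\<rparr>)"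
proof -
  obtain B where B: "finite_cbasis M B" using M by (auto simp: fd_module_def)
  note lm = fd_left_module[OF M]
  have "coordinate_map (M\<lparr>car := N\<rparr>) B (coords M B)"
    using coordinate_map_coords[OF lm B] N by (auto simp: coordinate_map_def submodule_def subset_iff)
  thus ?thesis using fd_moduleI[OF submodule_left_module[OF lm N]] by blast
qed

lemma cdim_submodule:
  assumes M: "fd_module M" and N: "submodule M N"
  shows "cdim (M\<lparr>car := N\<rparr>) \<le> cdim M"
    and "cdim (M\<lparr>car := N\<rparr>) = cdim M \<Longrightarrow> N = car M"
proof -
  note lm = fd_left_module[OF M]
  have NM: "N \<subseteq> car M" using N by (simp add: submodule_def)
  obtain B where B: "finite_cbasis (M\<lparr>car := N\<rparr>) B"
    using fd_submodule[OF M N] by (auto simp: fd_module_def)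
  note lmN = submodule_left_module[OF lm N]
  have d: "cdim (M\<lparr>car := N\<rparr>) = card B" by (rule cdim_eq_card[OF lmN B])
  have I: "lin_indep M B"
    using B NM by (auto simp: finite_cbasis_iff[OF lmN] lin_indep_def)
  show "cdim (M\<lparr>car := N\<rparr>) \<le> cdim M"
    using lin_indep_card_le_cdim[OF M I] d by simp
  assume "cdim (M\<lparr>car := N\<rparr>) = cdim M"
  hence B': "finite_cbasis M B" using lin_indep_card_eq_cdim[OF M I] d by simp
  have "x \<in> N" if x: "x \<in> car M" for x
  proof -
    obtain c where "x = (\<Sum>b\<in>B. cscale M (c b) b)"
      using finite_cbasis_span[OF B' x] ..
    moreover have "b \<in> N" if "b \<in> B" for b
      using that B by (auto simp: finite_cbasis_def)
    ultimately have "x \<in> car (M\<lparr>car := N\<rparr>)"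
      using sum_in_car[OF lmN, of B "\<lambda>b. cscale M (c b) b"] cscale_in_car[OF lmN] by simp
    thus ?thesis by simp
  qed
  thus "N = car M" using NM by blast
qed

lemma lin_indep_image:
  assumes M: "left_module M" and f: "f \<in> module_hom M N" and inj: "inj_on f (car M)"
    and I: "lin_indep M I"
  shows "lin_indep N (f ` I)"
proof -
  have IM: "I \<subseteq> car M" and fI: "finite I" using I by (auto simp: lin_indep_def)
  have injI: "inj_on f I" using inj_on_subset[OF inj IM] .
  have "\<forall>b\<in>I. c (f b) = 0" if c: "(\<Sum>b\<in>f ` I. cscale N (c b) b) = 0" for c
  proof -
    have "f (\<Sum>b\<in>I. cscale M (c (f b)) b) = (\<Sum>b\<in>I. f (cscale M (c (f b)) b))"
      using IM by (intro hom_sum[OF M f]) (auto simp: cscale_in_car[OF M])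
    also have "\<dots> = (\<Sum>b\<in>I. cscale N (c (f b)) (f b))"
      using IM by (intro sum.cong) (auto simp: hom_cscale[OF f])
    also have "\<dots> = 0" using c by (simp add: sum.reindex[OF injI])
    finally have "f (\<Sum>b\<in>I. cscale M (c (f b)) b) = f 0" by (simp add: hom_zero[OF M f])
    hence "(\<Sum>b\<in>I. cscale M (c (f b)) b) = 0"
      using IM by (subst (asm) inj_on_eq_iff[OF inj])
        (auto intro!: sum_in_car[OF M] cscale_in_car[OF M] zero_in_car[OF M])
    thus ?thesis using I unfolding lin_indep_def by (elim conjE allE[of _ "\<lambda>b. c (f b)"]) auto
  qed
  thus ?thesis using fI IM hom_in_car[OF f] by (auto simp: lin_indep_def)
qed

lemma fd_module_iso:
  assumes M: "fd_module M" and N: "left_module N" and f: "f \<in> module_iso M N"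
  shows "fd_module N"
proof -
  note lm = fd_left_module[OF M]
  obtain B where B: "finite_cbasis M B" using M by (auto simp: fd_module_def)
  let ?g = "inv_into (car M) f"
  have "?g \<in> module_iso N M" using iso_inverse[OF lm f] .
  hence g: "?g \<in> module_hom N M" and inj: "inj_on ?g (car N)"
    by (auto simp: module_iso_def bij_betw_def)
  have "x = 0" if "x \<in> car N" "?g x = 0" for x
    using inj_onD[OF inj, of x 0] that zero_in_car[OF N] hom_zero[OF N g] by simp
  hence "coordinate_map N B (\<lambda>x. coords M B (?g x))"
    using coordinate_map_coords[OF lm B] hom_add[OF g] hom_cscale[OF g] hom_in_car[OF g]
    by (simp add: coordinate_map_def)
  thus ?thesis using fd_moduleI[OF N] by blast
qed

text \<open>The image of a basis is independent and has full size, so it is a basis.\<close>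

lemma injective_endo_surjective:
  assumes M: "fd_module M" and f: "f \<in> module_hom M M" and inj: "inj_on f (car M)"
  shows "f ` car M = car M"
proof -
  note lm = fd_left_module[OF M]
  obtain B where B: "finite_cbasis M B" using M by (auto simp: fd_module_def)
  have BM: "B \<subseteq> car M" and IB: "lin_indep M B"
    using B by (auto simp: finite_cbasis_iff[OF lm] lin_indep_def)
  have injB: "inj_on f B" using inj_on_subset[OF inj BM] .
  have "finite_cbasis M (f ` B)"
    using lin_indep_card_eq_cdim[OF M lin_indep_image[OF lm f inj IB]]
      card_image[OF injB] cdim_eq_card[OF lm B] by simp
  hence "y \<in> f ` car M" if y: "y \<in> car M" for y
  proof -
    obtain c where "y = (\<Sum>b\<in>f ` B. cscale M (c b) b)"
      using finite_cbasis_span[OF \<open>finite_cbasis M (f ` B)\<close> y] ..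
    also have "\<dots> = (\<Sum>b\<in>B. f (cscale M (c (f b)) b))"
      using BM by (auto simp: sum.reindex[OF injB] hom_cscale[OF f] subset_iff intro!: sum.cong)
    also have "\<dots> = f (\<Sum>b\<in>B. cscale M (c (f b)) b)"
      using BM by (intro hom_sum[OF lm f, symmetric]) (auto intro!: cscale_in_car[OF lm])
    finally show ?thesis
      using BM by (auto intro!: imageI sum_in_car[OF lm] cscale_in_car[OF lm])
  qed
  thus ?thesis using hom_in_car[OF f] by auto
qed

text \<open>Preimages of a basis are independent, and would remain so after adding a nonzero kernel
  element, which the dimension forbids.\<close>

lemma surjective_endo_injective:
  assumes M: "fd_module M" and f: "f \<in> module_hom M M" and surj: "f ` car M = car M"
  shows "inj_on f (car M)"
proof (rule hom_inj_onI[OF fd_left_module[OF M] f], rule ccontr)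
  note lm = fd_left_module[OF M]
  fix x assume x: "x \<in> car M" "f x = 0" "x \<noteq> 0"
  obtain B where B: "finite_cbasis M B" using M by (auto simp: fd_module_def)
  have BM: "B \<subseteq> car M" and IB: "lin_indep M B" and fB: "finite B"
    using B by (auto simp: finite_cbasis_iff[OF lm] lin_indep_def)
  let ?g = "inv_into (car M) f"
  have fg: "f (?g b) = b" and gM: "?g b \<in> car M" if "b \<in> B" for b
    using that BM surj by (auto simp: f_inv_into_f inv_into_into subset_iff)
  have injg: "inj_on ?g B" using fg by (metis inj_onI)
  have "f (\<Sum>b\<in>?g ` B. cscale M (c b) b) = (\<Sum>b\<in>B. cscale M (c (?g b)) b)" for c
  proof -
    have "f (\<Sum>b\<in>?g ` B. cscale M (c b) b) = (\<Sum>b\<in>?g ` B. f (cscale M (c b) b))"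
      using gM by (intro hom_sum[OF lm f]) (auto intro!: cscale_in_car[OF lm])
    also have "\<dots> = (\<Sum>b\<in>B. cscale M (c (?g b)) b)"
      using gM fg by (auto simp: sum.reindex[OF injg] hom_cscale[OF f] intro!: sum.cong)
    finally show ?thesis .
  qed
  note f_sum = this
  have zero: "\<forall>b\<in>B. c (?g b) = 0" if "(\<Sum>b\<in>B. cscale M (c (?g b)) b) = 0" for c
    using IB that unfolding lin_indep_def by (elim conjE allE[of _ "\<lambda>b. c (?g b)"]) auto
  have "lin_indep M (?g ` B)"
    unfolding lin_indep_def
  proof (intro conjI allI impI)
    fix c assume "(\<Sum>b\<in>?g ` B. cscale M (c b) b) = 0"
    hence "\<forall>b\<in>B. c (?g b) = 0" using f_sum[of c] hom_zero[OF lm f] zero by simp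
    thus "\<forall>b\<in>?g ` B. c b = 0" by blast
  qed (use fB gM in auto)
  moreover have "x \<noteq> (\<Sum>b\<in>?g ` B. cscale M (c b) b)" for c
  proof
    assume eq: "x = (\<Sum>b\<in>?g ` B. cscale M (c b) b)"
    hence "\<forall>b\<in>B. c (?g b) = 0" using f_sum[of c] x zero by simp
    hence "x = 0" using eq gM by (auto simp: sum.reindex[OF injg] cscale_zero_left[OF lm])
    thus False using x by simp
  qed
  moreover have "x \<notin> ?g ` B"
  proof
    assume "x \<in> ?g ` B"
    then obtain b where b: "b \<in> B" "x = ?g b" by auto
    hence "b = 0" using fg x by auto
    moreover have "(\<Sum>b'\<in>B. cscale M (if b' = b then 1 else 0) b') = b"
      using b(1) fB BM by (subst sum.remove[OF fB b(1)])
        (auto simp: cscale_one[OF lm] cscale_zero_left[OF lm] subset_iff intro!: sum.neutral)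
    ultimately show False
      using IB b(1) unfolding lin_indep_def
      by (elim conjE allE[of _ "\<lambda>b'. if b' = b then 1 else 0"]) auto
  qed
  ultimately have "lin_indep M (insert x (?g ` B))" "card (insert x (?g ` B)) = Suc (cdim M)"
    using lin_indep_insert[OF lm, of "?g ` B" x] x(1) fB cdim_eq_card[OF lm B] card_image[OF injg]
    by auto
  thus False using lin_indep_card_le_cdim[OF M] by fastforce
qed


section \<open>Free and projective modules\<close>

text \<open>Free modules have to be found inside the ambient group of the universe. The map \<open>\<psi>\<close> expands the
  entries of a sequence of algebra elements in the basis \<open>a\<close> and arranges all the coordinates in one
  sequence by the pairing function. By the last property, \<open>n\<close>-tuples occupy only finitely many
  places; this is what makes free modules of finite rank finite-dimensional.\<close>

lemma free_embedding:
  fixes a :: "'d::finite \<Rightarrow> 'a::complex_algebra_1"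
  assumes a: "algebra_basis a"
  obtains \<psi> :: "(nat \<Rightarrow> 'a) \<Rightarrow> univ" where
    "\<And>u v. \<psi> (u + v) = \<psi> u + \<psi> v"
    "\<And>c u. \<psi> (\<lambda>j. c *\<^sub>C u j) = (\<lambda>m. c * \<psi> u m)"
    "\<And>u. \<psi> u = 0 \<Longrightarrow> u = 0"
    "\<And>n. \<exists>T. finite T \<and> (\<forall>u. (\<forall>j\<ge>n. u j = 0) \<longrightarrow> (\<forall>m. m \<notin> T \<longrightarrow> \<psi> u m = 0))"
proof -
  obtain \<alpha> :: "nat \<Rightarrow> 'd" where \<alpha>: "bij_betw \<alpha> {0..<CARD('d)} UNIV"
    using ex_bij_betw_nat_finite[of "UNIV :: 'd set"] by auto
  have ind: "cvs.independent (range a)" and sp: "\<And>v. v \<in> cvs.span (range a)"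
    using a by (auto simp: algebra_basis_def)
  let ?r = "cvs.representation (range a)"
  define \<psi> :: "(nat \<Rightarrow> 'a) \<Rightarrow> univ" where
    "\<psi> u m = (case prod_decode m of (j, q) \<Rightarrow> if q < CARD('d) then ?r (u j) (a (\<alpha> q)) else 0)" for u m
  have r0: "?r 0 b = 0" for b by (simp add: cvs.representation_zero)
  show thesis
  proof (rule that[of \<psi>])
    show "\<psi> (u + v) = \<psi> u + \<psi> v" for u v
      by (auto simp: \<psi>_def fun_eq_iff cvs.representation_add[OF ind sp sp] split: prod.splits)
    show "\<psi> (\<lambda>j. c *\<^sub>C u j) = (\<lambda>m. c * \<psi> u m)" for c u
      by (auto simp: \<psi>_def fun_eq_iff cvs.representation_scale[OF ind sp] split: prod.splits)
    show "u = 0" if "\<psi> u = 0" for u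
    proof
      fix j
      have "?r (u j) (a i) = 0" for i
      proof -
        obtain q where "q < CARD('d)" "i = \<alpha> q"
          using \<alpha> by (metis atLeastLessThan_iff bij_betw_imp_surj_on imageE UNIV_I)
        thus ?thesis using fun_cong[OF that, of "prod_encode (j, q)"] by (simp add: \<psi>_def)
      qed
      hence "{b. ?r (u j) b \<noteq> 0} = {}"
        using cvs.representation_ne_zero[of "range a" "u j"] by blast
      thus "u j = 0 j"
        using cvs.sum_nonzero_representation_eq[OF ind sp, of "u j"] by simp
    qed
    show "\<exists>T. finite T \<and> (\<forall>u. (\<forall>j\<ge>n. u j = 0) \<longrightarrow> (\<forall>m. m \<notin> T \<longrightarrow> \<psi> u m = 0))" for n
    proof (intro exI conjI allI impI)
      show "finite (prod_encode ` ({..<n} \<times> {..<CARD('d)}))" by simp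
      fix u :: "nat \<Rightarrow> 'a" and m assume u: "\<forall>j\<ge>n. u j = 0"
        and m: "m \<notin> prod_encode ` ({..<n} \<times> {..<CARD('d)})"
      obtain j q where jq: "prod_decode m = (j, q)" by (cases "prod_decode m")
      hence "m = prod_encode (j, q)" by (metis prod_decode_inverse)
      hence "\<not> (j < n \<and> q < CARD('d))" using m by auto
      thus "\<psi> u m = 0" using u by (auto simp: \<psi>_def jq r0)
    qed
  qed
qed

text \<open>The module structure of \<open>n\<close>-tuples of algebra elements is transported along \<open>\<psi>\<close>; \<open>\<epsilon> j\<close> is the
  image of the \<open>j\<close>-th unit vector.\<close>

lemma exists_free_module:
  fixes a :: "'d::finite \<Rightarrow> 'a::complex_algebra_1" and n :: nat
  assumes a: "algebra_basis a"
  shows "\<exists>(F :: 'a amod) \<epsilon>. fd_module F \<and> (\<forall>j<n. \<epsilon> j \<in> car F) \<and>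
    (\<forall>x\<in>car F. \<exists>u. x = (\<Sum>j<n. act F (u j) (\<epsilon> j))) \<and>
    (\<forall>(N :: 'a amod) y. left_module N \<longrightarrow> (\<forall>j<n. y j \<in> car N) \<longrightarrow>
        (\<exists>h\<in>module_hom F N. \<forall>j<n. h (\<epsilon> j) = y j))"
proof -
  obtain \<psi> :: "(nat \<Rightarrow> 'a) \<Rightarrow> univ" where add: "\<And>u v. \<psi> (u + v) = \<psi> u + \<psi> v"
    and sc: "\<And>c u. \<psi> (\<lambda>j. c *\<^sub>C u j) = (\<lambda>m. c * \<psi> u m)"
    and inj0: "\<And>u. \<psi> u = 0 \<Longrightarrow> u = 0"
    and supp: "\<And>n. \<exists>T. finite T \<and> (\<forall>u. (\<forall>j\<ge>n. u j = 0) \<longrightarrow> (\<forall>m. m \<notin> T \<longrightarrow> \<psi> u m = 0))"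
    using free_embedding[OF a] by blast
  have psi0: "\<psi> 0 = 0" using add[of 0 0] by simp
  have psim: "\<psi> (- u) = - \<psi> u" for u
    using add[of u "- u"] psi0 by (simp add: eq_neg_iff_add_eq_0 add.commute)
  have "inj \<psi>"
  proof (rule injI)
    fix u v assume "\<psi> u = \<psi> v"
    hence "\<psi> (u - v) = 0" using add[of "u - v" v] by simp
    thus "u = v" using inj0[of "u - v"] by simp
  qed
  hence inv: "inv \<psi> (\<psi> u) = u" for u by simp
  define U where "U = {u :: nat \<Rightarrow> 'a. \<forall>j\<ge>n. u j = 0}"
  define F where "F = \<lparr>car = \<psi> ` U, act = (\<lambda>r x. \<psi> (\<lambda>j. r * inv \<psi> x j))\<rparr>"
  have carF: "car F = \<psi> ` U" and actF: "act F r (\<psi> u) = \<psi> (\<lambda>j. r * u j)" for r u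
    by (simp_all add: F_def inv)
  have Uadd: "u + v \<in> U" and Uminus: "- u \<in> U" and Umult: "(\<lambda>j. r * u j) \<in> U"
    if "u \<in> U" "v \<in> U" for u v r using that by (auto simp: U_def)
  have lmF: "left_module F"
    unfolding left_module_def
  proof (intro conjI ballI allI)
    show "0 \<in> car F" unfolding carF by (rule image_eqI[of _ _ 0]) (auto simp: psi0 U_def)
  next
    fix x y assume "x \<in> car F" "y \<in> car F"
    then obtain u v where uv: "u \<in> U" "v \<in> U" "x = \<psi> u" "y = \<psi> v" by (auto simp: carF)
    show "x + y \<in> car F" unfolding carF uv add[symmetric] using Uadd uv by blast
    fix r :: 'a
    have "\<psi> (\<lambda>j. r * (u + v) j) = \<psi> ((\<lambda>j. r * u j) + (\<lambda>j. r * v j))"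
      by (rule arg_cong[of _ _ \<psi>]) (simp add: fun_eq_iff distrib_left)
    thus "act F r (x + y) = act F r x + act F r y"
      by (simp add: uv add[symmetric] actF del: plus_fun_apply)
  next
    fix x assume "x \<in> car F"
    then obtain u where u: "u \<in> U" "x = \<psi> u" by (auto simp: carF)
    show "- x \<in> car F" unfolding carF u psim[symmetric] using Uminus u by blast
    show "act F 1 x = x" by (simp add: u actF)
    fix r
    show "act F r x \<in> car F" unfolding u actF unfolding carF using Umult u by blast
    fix q
    have "\<psi> (\<lambda>j. (r + q) * u j) = \<psi> ((\<lambda>j. r * u j) + (\<lambda>j. q * u j))"
      by (rule arg_cong[of _ _ \<psi>]) (simp add: fun_eq_iff distrib_right)
    thus "act F (r + q) x = act F r x + act F q x" by (simp add: u actF add)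
    show "act F (r * q) x = act F r (act F q x)" by (simp add: u actF mult.assoc)
  qed
  obtain T where T: "finite T" "\<And>u m. u \<in> U \<Longrightarrow> m \<notin> T \<Longrightarrow> \<psi> u m = 0"
    using supp[of n] by (auto simp: U_def)
  have "cscale F c (\<psi> u) = (\<lambda>m. c * \<psi> u m)" for c u
    using sc[of c u] by (simp add: cscale_def actF mult_scaleC_left)
  hence "coordinate_map F T (\<lambda>x. x)"
    using T by (auto simp: coordinate_map_def carF)
  hence fd: "fd_module F" by (rule fd_moduleI[OF lmF])
  define \<epsilon> where "\<epsilon> j = \<psi> (\<lambda>i. if i = j then 1 else 0)" for j
  have \<epsilon>_in: "\<forall>j<n. \<epsilon> j \<in> car F" by (auto simp: \<epsilon>_def carF U_def)
  have psi_sum: "\<psi> u = (\<Sum>j<n. act F (u j) (\<epsilon> j))" if "u \<in> U" for u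
  proof -
    have ps: "\<psi> (\<Sum>j\<in>A. h j) = (\<Sum>j\<in>A. \<psi> (h j))" for A :: "nat set" and h
      by (induction A rule: infinite_finite_induct)
        (simp_all only: sum.infinite sum.empty sum.insert psi0 add not_False_eq_True)
    have sum_ap: "(\<Sum>j\<in>A. h j) i = (\<Sum>j\<in>A. h j i)" for A :: "nat set" and h :: "nat \<Rightarrow> nat \<Rightarrow> 'a" and i
      by (induction A rule: infinite_finite_induct) auto
    have "u = (\<Sum>j<n. (\<lambda>i. u j * (if i = j then 1 else 0)))"
      using that by (auto simp: fun_eq_iff sum_ap U_def if_distrib cong: if_cong)
    hence "\<psi> u = (\<Sum>j<n. \<psi> (\<lambda>i. u j * (if i = j then 1 else 0)))"
      using ps by metis
    thus ?thesis by (simp add: \<epsilon>_def actF)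
  qed
  have univ: "\<exists>h\<in>module_hom F N. \<forall>j<n. h (\<epsilon> j) = y j"
    if N: "left_module N" and y: "\<forall>j<n. y j \<in> car N" for N :: "'a amod" and y
  proof
    let ?h = "\<lambda>x. \<Sum>j<n. act N (inv \<psi> x j) (y j)"
    show "?h \<in> module_hom F N"
      unfolding module_hom_def
    proof (intro CollectI conjI ballI allI)
      fix x assume "x \<in> car F"
      show "?h x \<in> car N" using y by (auto intro!: sum_in_car[OF N] act_in_car[OF N])
    next
      fix x z assume "x \<in> car F" "z \<in> car F"
      then obtain u v where uv: "x = \<psi> u" "z = \<psi> v" by (auto simp: carF)
      show "?h (x + z) = ?h x + ?h z"
        using y by (simp add: uv add[symmetric] inv act_add_left[OF N] sum.distrib)
    next
      fix r x assume "x \<in> car F"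
      then obtain u where u: "x = \<psi> u" by (auto simp: carF)
      have "act N r (?h x) = (\<Sum>j<n. act N r (act N (u j) (y j)))"
        using y unfolding u inv by (intro act_sum_right[OF N] act_in_car[OF N]) auto
      thus "?h (act F r x) = act N r (?h x)"
        using y by (simp add: u actF inv act_mult[OF N])
    qed
    show "\<forall>j<n. ?h (\<epsilon> j) = y j"
    proof (intro allI impI)
      fix j assume j: "j < n"
      have "?h (\<epsilon> j) = (\<Sum>i<n. if i = j then y i else 0)"
        unfolding \<epsilon>_def inv using y by (intro sum.cong) (auto simp: act_one[OF N] act_zero_left[OF N])
      thus "?h (\<epsilon> j) = y j" using j by simp
    qed
  qed
  show ?thesis
    using fd \<epsilon>_in univ psi_sum by (intro exI[of _ F] exI[of _ \<epsilon>]) (auto simp: carF)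
qed

lemma projective_left_module: "projective P \<Longrightarrow> left_module P"
  by (simp add: projective_def)

lemma projective_lift:
  fixes N N' :: "'a::complex_algebra_1 amod"
  assumes "projective P" "left_module N" "left_module N'" "g \<in> module_hom N N'"
    "g ` car N = car N'" "f \<in> module_hom P N'"
  obtains h where "h \<in> module_hom P N" "\<And>x. x \<in> car P \<Longrightarrow> g (h x) = f x"
  using assms(1)[unfolded projective_def, THEN conjunct2, rule_format, of N N' g f] assms(2-) that
  by blast

lemma projective_retract:
  assumes P: "projective P" and Q: "left_module (Q :: 'a::complex_algebra_1 amod)"
    and i: "i \<in> module_hom Q P" and r: "r \<in> module_hom P Q"
    and ri: "\<And>x. x \<in> car Q \<Longrightarrow> r (i x) = x"
  shows "projective Q"
  unfolding projective_def
proof (intro conjI Q allI impI, elim conjE)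
  fix N N' :: "'a amod" and g f
  assume N: "left_module N" "left_module N'" "g \<in> module_hom N N'" "g ` car N = car N'"
    and f: "f \<in> module_hom Q N'"
  obtain h where h: "h \<in> module_hom P N" "\<And>x. x \<in> car P \<Longrightarrow> g (h x) = f (r x)"
    using projective_lift[OF P N hom_compose[OF r f]] by blast
  show "\<exists>h\<in>module_hom Q N. \<forall>x\<in>car Q. g (h x) = f x"
    using hom_compose[OF i h(1)] h(2)[OF hom_in_car[OF i]] ri by (intro bexI) auto
qed

lemma projective_iso:
  assumes P: "projective P" and Q: "left_module (Q :: 'a::complex_algebra_1 amod)"
    and f: "f \<in> module_iso P Q"
  shows "projective Q"
proof (rule projective_retract[OF P Q])
  show "inv_into (car P) f \<in> module_hom Q P"
    using iso_inverse[OF projective_left_module[OF P] f] by (simp add: module_iso_def)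
  show "f \<in> module_hom P Q" using f by (simp add: module_iso_def)
  show "f (inv_into (car P) f x) = x" if "x \<in> car Q" for x
    using f that by (auto simp: module_iso_def bij_betw_def f_inv_into_f)
qed

text \<open>A \<open>\<complex>\<close>-basis of \<open>M\<close> generates \<open>M\<close> over the algebra, so the free module on it maps
  onto \<open>M\<close>. Free modules are projective since preimages of the generators can be prescribed.\<close>

lemma exists_projective_surjection:
  fixes a :: "'d::finite \<Rightarrow> 'a::complex_algebra_1"
  assumes a: "algebra_basis a"
    and M: "fd_module (M :: 'a amod)"
  shows "\<exists>(P :: 'a amod) e. fd_module P \<and> projective P \<and> e \<in> module_hom P M \<and> e ` car P = car M"
proof -
  note lm = fd_left_module[OF M]
  obtain B where B: "finite_cbasis M B" using M by (auto simp: fd_module_def)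
  hence BM: "B \<subseteq> car M" and fB: "finite B" by (auto simp: finite_cbasis_def)
  obtain b where b: "bij_betw b {0..<card B} B" using ex_bij_betw_nat_finite[OF fB] by blast
  hence bB: "b j \<in> car M" if "j < card B" for j
    using that BM by (auto simp: bij_betw_def)
  obtain F :: "'a amod" and \<epsilon> where fd: "fd_module F" and \<epsilon>: "\<forall>j<card B. \<epsilon> j \<in> car F"
    and gen: "\<forall>x\<in>car F. \<exists>u. x = (\<Sum>j<card B. act F (u j) (\<epsilon> j))"
    and univ: "\<forall>(N :: 'a amod) y. left_module N \<longrightarrow> (\<forall>j<card B. y j \<in> car N) \<longrightarrow>
        (\<exists>h\<in>module_hom F N. \<forall>j<card B. h (\<epsilon> j) = y j)"
    using exists_free_module[OF a, of "card B"] by blast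
  note lmF = fd_left_module[OF fd]
  have hom_gen: "h (\<Sum>j<card B. act F (u j) (\<epsilon> j)) = (\<Sum>j<card B. act N (u j) (h (\<epsilon> j)))"
    if "h \<in> module_hom F N" for h u and N :: "'a amod"
  proof -
    have "h (\<Sum>j<card B. act F (u j) (\<epsilon> j)) = (\<Sum>j<card B. h (act F (u j) (\<epsilon> j)))"
      using \<epsilon> by (intro hom_sum[OF lmF that]) (auto simp: act_in_car[OF lmF])
    thus ?thesis using \<epsilon> by (simp add: hom_act[OF that])
  qed
  have "projective F"
    unfolding projective_def
  proof (intro conjI lmF allI impI, elim conjE)
    fix N N' :: "'a amod" and g f
    assume N: "left_module N" "left_module N'" and g: "g \<in> module_hom N N'"
      and surj: "g ` car N = car N'" and f: "f \<in> module_hom F N'"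
    have "\<forall>j<card B. \<exists>y. y \<in> car N \<and> g y = f (\<epsilon> j)"
      using hom_in_car[OF f] \<epsilon> surj by (metis imageE)
    then obtain y where y: "\<forall>j<card B. y j \<in> car N \<and> g (y j) = f (\<epsilon> j)" by metis
    then obtain h where h: "h \<in> module_hom F N" "\<forall>j<card B. h (\<epsilon> j) = y j"
      using univ N(1) by blast
    have "g (h x) = f x" if x: "x \<in> car F" for x
    proof -
      obtain u where u: "x = (\<Sum>j<card B. act F (u j) (\<epsilon> j))" using gen x by blast
      show ?thesis
        using hom_gen[OF hom_compose[OF h(1) g], of u] hom_gen[OF f, of u] h(2) y
        by (simp add: u)
    qed
    thus "\<exists>h\<in>module_hom F N. \<forall>x\<in>car F. g (h x) = f x" using h(1) by blast
  qed
  moreover obtain e where e: "e \<in> module_hom F M" "\<forall>j<card B. e (\<epsilon> j) = b j"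
    using univ lm bB by blast
  moreover have "e ` car F = car M"
  proof
    show "e ` car F \<subseteq> car M" using hom_in_car[OF e(1)] by blast
    show "car M \<subseteq> e ` car F"
    proof
      fix x assume "x \<in> car M"
      then obtain c where "x = (\<Sum>b\<in>B. cscale M (c b) b)" using finite_cbasis_span[OF B] by blast
      also have "\<dots> = (\<Sum>j<card B. cscale M (c (b j)) (b j))"
        using sum.reindex_bij_betw[OF b, of "\<lambda>b. cscale M (c b) b"] by (simp add: atLeast0LessThan)
      also have "\<dots> = e (\<Sum>j<card B. act F (c (b j) *\<^sub>C 1) (\<epsilon> j))"
        by (simp add: hom_gen[OF e(1)] e(2) cscale_def)
      finally show "x \<in> e ` car F"
        using \<epsilon> by (auto intro!: sum_in_car[OF lmF] act_in_car[OF lmF])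
    qed
  qed
  ultimately show ?thesis using fd by blast
qed

section \<open>Projective covers and minimal resolutions\<close>

text \<open>A surjection from a projective module of least possible dimension is a projective cover. If
  \<open>N + ker e = P\<close>, then \<open>e\<close> lifts along its restriction to \<open>N\<close>, which gives an endomorphism \<open>h\<close> of
  \<open>P\<close> with \<open>e \<circ> h = e\<close> and image inside \<open>N\<close>. Among all such \<open>h\<close> one with image of least dimension
  satisfies \<open>h (h P) = h P\<close>, so it is bijective on its image; this image is therefore a direct
  summand of \<open>P\<close>, and \<open>e\<close> still maps it onto \<open>M\<close>, so minimality of \<open>P\<close> makes it everything.\<close>

lemma minimal_surjection_superfluous:
  fixes M :: "'a::complex_algebra_1 amod"
  assumes P: "fd_module P" "projective P" and M: "left_module M"
    and e: "e \<in> module_hom P M" "e ` car P = car M"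
    and min: "\<And>(P' :: 'a amod) e'. fd_module P' \<Longrightarrow> projective P' \<Longrightarrow>
      e' \<in> module_hom P' M \<Longrightarrow> e' ` car P' = car M \<Longrightarrow> cdim P \<le> cdim P'"
  shows "superfluous P (kernel P e)"
  unfolding superfluous_def
proof (intro allI impI, elim conjE)
  fix N assume N: "submodule P N" and NK: "{x + y |x y. x \<in> N \<and> y \<in> kernel P e} = car P"
  note lm = fd_left_module[OF P(1)]
  have NP: "N \<subseteq> car P" using N by (simp add: submodule_def)
  define H where "H h \<longleftrightarrow> h \<in> module_hom P P \<and> h ` car P \<subseteq> N \<and> (\<forall>x\<in>car P. e (h x) = e x)" for h
  define im where "im h = P\<lparr>car := h ` car P\<rparr>" for h
  have eN: "e \<in> module_hom (P\<lparr>car := N\<rparr>) M"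
    using e(1) NP by (auto simp: module_hom_def subset_iff)
  have "car M \<subseteq> e ` N"
  proof
    fix z assume "z \<in> car M"
    then obtain p where p: "p \<in> car P" "z = e p" using e(2) by auto
    then obtain x y where "p = x + y" "x \<in> N" "y \<in> kernel P e" using NK by blast
    hence "z = e x" using p hom_add[OF e(1), of x y] NP by (auto simp: kernel_def)
    thus "z \<in> e ` N" using \<open>x \<in> N\<close> by blast
  qed
  hence surjN: "e ` car (P\<lparr>car := N\<rparr>) = car M" using NP e by auto
  obtain h0 where "h0 \<in> module_hom P (P\<lparr>car := N\<rparr>)" "\<And>x. x \<in> car P \<Longrightarrow> e (h0 x) = e x"
    using projective_lift[OF P(2) submodule_left_module[OF lm N] M eN surjN e(1)] by blast
  hence "H h0" using NP by (auto simp: H_def module_hom_def)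
  \<comment> \<open>an endomorphism over \<open>M\<close> with the smallest image inside \<open>N\<close>\<close>
  then obtain h where Hh: "H h" and hmin: "\<And>h'. H h' \<Longrightarrow> cdim (im h) \<le> cdim (im h')"
    using ex_has_least_nat[of H h0 "\<lambda>h. cdim (im h)"] by blast
  hence h: "h \<in> module_hom P P" and hN: "h ` car P \<subseteq> N" and eh: "\<And>x. x \<in> car P \<Longrightarrow> e (h x) = e x"
    by (auto simp: H_def)
  have sub: "submodule P (h ` car P)" by (rule image_submodule[OF lm h])
  have fdQ: "fd_module (im h)" unfolding im_def by (rule fd_submodule[OF P(1) sub])
  note lmQ = fd_left_module[OF fdQ]
  have hQ: "h \<in> module_hom (im h) (im h)"
    using h hom_in_car[OF h] by (auto simp: module_hom_def im_def)
  have "H (\<lambda>x. h (h x))"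
    using hom_compose[OF h h] hN eh hom_in_car[OF h] by (auto simp: H_def)
  hence "cdim (im h) \<le> cdim ((im h)\<lparr>car := h ` car (im h)\<rparr>)"
    using hmin[of "\<lambda>x. h (h x)"] by (simp add: im_def image_image)
  moreover have subQ: "submodule (im h) (h ` car (im h))" by (rule image_submodule[OF lmQ hQ])
  ultimately have surj: "h ` car (im h) = car (im h)"
    using cdim_submodule[OF fdQ subQ] by simp
  hence inj: "inj_on h (car (im h))" by (rule surjective_endo_injective[OF fdQ hQ])
  hence iso: "h \<in> module_iso (im h) (im h)"
    using hQ surj by (simp add: module_iso_def bij_betw_def)
  \<comment> \<open>\<open>?s \<circ> h\<close> retracts \<open>P\<close> onto the image of \<open>h\<close>\<close>
  let ?s = "inv_into (car (im h)) h"
  have s: "?s \<in> module_hom (im h) (im h)"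
    using iso_inverse[OF lmQ iso] by (simp add: module_iso_def)
  have hPQ: "h \<in> module_hom P (im h)" using h by (auto simp: module_hom_def im_def)
  have "projective (im h)"
  proof (rule projective_retract[OF P(2) lmQ])
    show "(\<lambda>x. x) \<in> module_hom (im h) P" using hom_in_car[OF h] by (auto simp: module_hom_def im_def)
    show "(\<lambda>x. ?s (h x)) \<in> module_hom P (im h)" by (rule hom_compose[OF hPQ s])
    show "?s (h x) = x" if "x \<in> car (im h)" for x using inv_into_f_f[OF inj that] .
  qed
  moreover have "e \<in> module_hom (im h) M"
    using e(1) hom_in_car[OF h] by (auto simp: module_hom_def im_def)
  moreover have "e ` car (im h) = car M"
    using e(2) eh by (auto simp: im_def image_image cong: image_cong)
  ultimately have "cdim P \<le> cdim (im h)" using min fdQ by blast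
  hence "h ` car P = car P"
    using cdim_submodule[OF P(1) sub] by (simp add: im_def)
  thus "N = car P" using hN NP by blast
qed

definition projective_cover ::
  "'a::complex_algebra_1 amod \<Rightarrow> 'a amod \<Rightarrow> (univ \<Rightarrow> univ) \<Rightarrow> bool" where
  "projective_cover M P e \<longleftrightarrow> fd_module P \<and> projective P \<and> e \<in> module_hom P M \<and>
     e ` car P = car M \<and> superfluous P (kernel P e)"

lemma exists_projective_cover:
  fixes a :: "'d::finite \<Rightarrow> 'a::complex_algebra_1"
  assumes a: "algebra_basis a"
    and M: "fd_module (M :: 'a amod)"
  shows "\<exists>P e. projective_cover M P e"
proof -
  define R where "R = (\<lambda>(P :: 'a amod, e).
    fd_module P \<and> projective P \<and> e \<in> module_hom P M \<and> e ` car P = car M)"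
  obtain x0 where "R x0"
    using exists_projective_surjection[OF a M] by (auto simp: R_def)
  then obtain x where x: "R x" "\<And>y. R y \<Longrightarrow> cdim (fst x) \<le> cdim (fst y)"
    using ex_has_least_nat[of R x0 "\<lambda>x. cdim (fst x)"] by blast
  obtain P e where Pe: "x = (P, e)" by (cases x)
  have "superfluous P (kernel P e)"
    using x unfolding Pe R_def
    by (intro minimal_surjection_superfluous[OF _ _ fd_left_module[OF M]]) auto
  thus ?thesis using x(1) by (auto simp: Pe R_def projective_cover_def)
qed

text \<open>Iterated covers: in the sequence of triples \<open>(K, P, e)\<close> built here, \<open>K\<close> is the \<open>n\<close>-th syzygy of
  \<open>M\<close>, covered by \<open>e\<close> from \<open>P\<close>, and the next \<open>K\<close> is the kernel of \<open>e\<close>.\<close>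

lemma exists_minimal_projective_resolution:
  fixes a :: "'d::finite \<Rightarrow> 'a::complex_algebra_1"
  assumes a: "algebra_basis a"
    and M: "fd_module (M :: 'a amod)"
  shows "\<exists>P d e. minimal_projective_resolution M P d e"
proof -
  define good where "good = (\<lambda>n (K :: 'a amod, P, e).
    fd_module K \<and> projective_cover K P e \<and> (n = (0::nat) \<longrightarrow> K = M))"
  define nxt where "nxt = (\<lambda>(n::nat) (K :: 'a amod, P, e :: univ \<Rightarrow> univ) (K' :: 'a amod, P' :: 'a amod, e' :: univ \<Rightarrow> univ).
    K' = P\<lparr>car := kernel P e\<rparr>)"
  have "\<exists>x. good 0 x" using exists_projective_cover[OF a M] M by (auto simp: good_def)
  moreover have "\<exists>y. good (Suc n) y \<and> nxt n x y" if x: "good n x" for x n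
  proof -
    obtain K P e where e: "x = (K, P, e)" by (cases x)
    have "fd_module (P\<lparr>car := kernel P e\<rparr>)"
      using x unfolding e good_def projective_cover_def
      by (auto intro!: fd_submodule kernel_submodule intro: fd_left_module)
    thus ?thesis
      using exists_projective_cover[OF a] by (fastforce simp: good_def nxt_def e)
  qed
  ultimately obtain f where f: "\<And>n. good n (f n)" "\<And>n. nxt n (f n) (f (Suc n))"
    using dependent_nat_choice[of good nxt] by metis
  define K where "K n = fst (f n)" for n
  define P where "P n = fst (snd (f n))" for n
  define e where "e n = snd (snd (f n))" for n
  have cov: "projective_cover (K n) (P n) (e n)" for n
    using f(1)[of n] by (auto simp: good_def K_def P_def e_def split: prod.splits)
  have K0: "K 0 = M" using f(1)[of 0] by (auto simp: good_def K_def split: prod.splits)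
  have KS: "K (Suc n) = (P n)\<lparr>car := kernel (P n) (e n)\<rparr>" for n
    using f(2)[of n] by (auto simp: nxt_def K_def P_def e_def split: prod.splits)
  have "e (Suc n) \<in> module_hom (P (Suc n)) (P n)" for n
    using cov[of "Suc n"] by (auto simp: KS projective_cover_def module_hom_def kernel_def)
  moreover have "e (Suc n) ` car (P (Suc n)) = kernel (P n) (e n)" for n
    using cov[of "Suc n"] by (auto simp: KS projective_cover_def)
  ultimately have "minimal_projective_resolution M P (\<lambda>n. e (Suc n)) (e 0)"
    using cov cov[of 0]
    unfolding minimal_projective_resolution_def projective_resolution_def projective_cover_def
    by (auto simp: K0)
  thus ?thesis by blast
qed

section \<open>Comparison of resolutions\<close>

text \<open>The kernel out of degree \<open>n\<close>: treating the augmentation as the differential of degree \<open>0\<close> spares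
  the case distinction in the inductions below.\<close>

definition syzygy ::
  "(nat \<Rightarrow> 'a::complex_algebra_1 amod) \<Rightarrow> (nat \<Rightarrow> univ \<Rightarrow> univ) \<Rightarrow> (univ \<Rightarrow> univ) \<Rightarrow> nat \<Rightarrow> univ set" where
  "syzygy P d e n = (case n of 0 \<Rightarrow> kernel (P 0) e | Suc m \<Rightarrow> kernel (P (Suc m)) (d m))"

lemma syzygy_0 [simp]: "syzygy P d e 0 = kernel (P 0) e"
  and syzygy_Suc [simp]: "syzygy P d e (Suc n) = kernel (P (Suc n)) (d n)"
  by (simp_all add: syzygy_def)

lemma projective_resolutionD:
  assumes "projective_resolution M P d e"
  shows "projective (P n)" "e \<in> module_hom (P 0) M" "d n \<in> module_hom (P (Suc n)) (P n)"
    "e ` car (P 0) = car M" "d n ` car (P (Suc n)) = syzygy P d e n"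
  using assms unfolding projective_resolution_def by (cases n; simp)+

lemma syzygy_submodule:
  assumes M: "left_module M" and P: "projective_resolution M P d e"
  shows "submodule (P n) (syzygy P d e n)"
  by (cases n)
    (auto intro!: kernel_submodule M projective_left_module[OF projective_resolutionD(1)[OF P]]
      projective_resolutionD(2,3)[OF P])

text \<open>Given the map in degree \<open>n\<close>, the next one is a lift along the surjection of \<open>Q (Suc n)\<close> onto the
  syzygy of \<open>Q\<close> in degree \<open>n\<close>. The induction therefore carries along that syzygies are mapped to
  syzygies.\<close>

lemma comparison_chain_map:
  assumes M: "left_module M" and P: "projective_resolution M P d e"
    and Q: "projective_resolution M Q d' e'"
  obtains f where "\<And>n. f n \<in> module_hom (P n) (Q n)" "\<And>x. x \<in> car (P 0) \<Longrightarrow> e' (f 0 x) = e x"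
    "\<And>n x. x \<in> car (P (Suc n)) \<Longrightarrow> d' n (f (Suc n) x) = f n (d n x)"
proof -
  note P' = projective_resolutionD[OF P] and Q' = projective_resolutionD[OF Q]
  note lmP = projective_left_module[OF P'(1)] and lmQ = projective_left_module[OF Q'(1)]
  define good where "good n f \<longleftrightarrow> f \<in> module_hom (P n) (Q n) \<and>
    f ` syzygy P d e n \<subseteq> syzygy Q d' e' n \<and>
    (n = 0 \<longrightarrow> (\<forall>x\<in>car (P 0). e' (f x) = e x))" for n f
  define nxt where "nxt n f f' \<longleftrightarrow> (\<forall>x\<in>car (P (Suc n)). d' n (f' x) = f (d n x))"
    for n and f f' :: "univ \<Rightarrow> univ"
  obtain f0 where "f0 \<in> module_hom (P 0) (Q 0)" "\<And>x. x \<in> car (P 0) \<Longrightarrow> e' (f0 x) = e x"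
    using projective_lift[OF P'(1) lmQ M Q'(2,4) P'(2)] by blast
  hence "good 0 f0" by (auto simp: good_def kernel_def module_hom_def)
  hence "\<exists>f. good 0 f" by blast
  moreover have "\<exists>f'. good (Suc n) f' \<and> nxt n f f'" if f: "good n f" for f n
  proof -
    let ?S = "(Q n)\<lparr>car := syzygy Q d' e' n\<rparr>"
    have S: "left_module ?S" by (rule submodule_left_module[OF lmQ syzygy_submodule[OF M Q]])
    have d'S: "d' n \<in> module_hom (Q (Suc n)) ?S"
      using Q'(3)[of n] Q'(5)[of n] by (auto simp: module_hom_def)
    have im: "d n x \<in> syzygy P d e n" if "x \<in> car (P (Suc n))" for x
      using P'(5)[of n] that by blast
    have "(\<lambda>x. f (d n x)) \<in> module_hom (P (Suc n)) (Q n)"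
      using f by (intro hom_compose[OF P'(3)]) (auto simp: good_def)
    hence "(\<lambda>x. f (d n x)) \<in> module_hom (P (Suc n)) ?S"
      using f im by (auto simp: good_def module_hom_def)
    then obtain f' where f': "f' \<in> module_hom (P (Suc n)) (Q (Suc n))"
      "\<And>x. x \<in> car (P (Suc n)) \<Longrightarrow> d' n (f' x) = f (d n x)"
      using projective_lift[OF P'(1) lmQ S d'S _, of "\<lambda>x. f (d n x)" "Suc n"] Q'(5)[of n] by auto
    have "f 0 = 0" using f hom_zero[OF lmP] by (auto simp: good_def)
    hence "good (Suc n) f'"
      using f' hom_in_car[OF f'(1)] by (auto simp: good_def kernel_def)
    thus ?thesis using f'(2) by (auto simp: nxt_def)
  qed
  ultimately obtain f where "\<And>n. good n (f n)" "\<And>n. nxt n (f n) (f (Suc n))"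
    using dependent_nat_choice[of good nxt] by metis
  thus thesis by (intro that[of f]) (auto simp: good_def nxt_def)
qed

text \<open>An endomorphism of a minimal resolution over the identity is surjective in every degree: its
  image together with the superfluous syzygy is everything. Being injective as well, it maps each
  syzygy onto itself, which carries the argument to the next degree.\<close>

lemma minimal_resolution_endo_surjective:
  assumes M: "fd_module M" and N: "minimal_projective_resolution M N d e"
    and \<phi>: "\<And>n. \<phi> n \<in> module_hom (N n) (N n)" and \<phi>0: "\<And>x. x \<in> car (N 0) \<Longrightarrow> e (\<phi> 0 x) = e x"
    and \<phi>d: "\<And>n x. x \<in> car (N (Suc n)) \<Longrightarrow> d n (\<phi> (Suc n) x) = \<phi> n (d n x)"
  shows "\<phi> n ` car (N n) = car (N n)"
proof -
  have res: "projective_resolution M N d e" and fd: "\<And>n. fd_module (N n)"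
    and sf: "superfluous (N n) (syzygy N d e n)" for n
    using N by (auto simp: minimal_projective_resolution_def syzygy_def split: nat.splits)
  note N' = projective_resolutionD[OF res] and lm = fd_left_module[OF fd]
  note sub = syzygy_submodule[OF fd_left_module[OF M] res]
  have surjI: "\<phi> n ` car (N n) = car (N n)"
    if ex: "\<And>x. x \<in> car (N n) \<Longrightarrow> \<exists>y\<in>car (N n). x - \<phi> n y \<in> syzygy N d e n" for n
  proof -
    have subs: "syzygy N d e n \<subseteq> car (N n)" using sub[of n] by (simp add: submodule_def)
    have "\<exists>u v. x = u + v \<and> u \<in> \<phi> n ` car (N n) \<and> v \<in> syzygy N d e n"
      if x: "x \<in> car (N n)" for x
    proof -
      obtain y where "y \<in> car (N n)" "x - \<phi> n y \<in> syzygy N d e n"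
        using ex[OF x] by blast
      thus ?thesis by (intro exI[of _ "\<phi> n y"] exI[of _ "x - \<phi> n y"]) auto
    qed
    hence "{u + v |u v. u \<in> \<phi> n ` car (N n) \<and> v \<in> syzygy N d e n} = car (N n)"
      using subs hom_in_car[OF \<phi>] add_in_car[OF lm] by blast
    thus ?thesis
      using sf image_submodule[OF lm \<phi>] unfolding superfluous_def by blast
  qed
  have syz: "\<phi> n ` syzygy N d e n = syzygy N d e n" if surj: "\<phi> n ` car (N n) = car (N n)" for n
  proof -
    let ?S = "(N n)\<lparr>car := syzygy N d e n\<rparr>"
    have subs: "syzygy N d e n \<subseteq> car (N n)" using sub[of n] by (simp add: submodule_def)
    have "\<phi> n x \<in> syzygy N d e n" if "x \<in> syzygy N d e n" for x
    proof (cases n)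
      case 0
      thus ?thesis using that \<phi>0 hom_in_car[OF \<phi>] by (auto simp: kernel_def)
    next
      case (Suc m)
      thus ?thesis
        using that \<phi>d hom_in_car[OF \<phi>] hom_zero[OF lm \<phi>] by (auto simp: kernel_def)
    qed
    hence "\<phi> n \<in> module_hom ?S ?S" using \<phi>[of n] subs by (auto simp: module_hom_def subset_iff)
    moreover have "inj_on (\<phi> n) (car ?S)"
      using surjective_endo_injective[OF fd \<phi> surj] subs by (auto intro: inj_on_subset)
    ultimately show ?thesis
      using injective_endo_surjective[OF fd_submodule[OF fd sub], of "\<phi> n" n] by simp
  qed
  show ?thesis
  proof (induction n)
    case 0
    have "x - \<phi> 0 x \<in> syzygy N d e 0" if "x \<in> car (N 0)" for x
      using that \<phi>0 hom_in_car[OF \<phi>] diff_in_car[OF lm] hom_diff[OF lm N'(2)]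
      by (auto simp: kernel_def)
    thus ?case by (intro surjI) blast
  next
    case (Suc n)
    show ?case
    proof (rule surjI)
      fix x assume x: "x \<in> car (N (Suc n))"
      hence "d n x \<in> \<phi> n ` syzygy N d e n" using syz[OF Suc] N'(5)[of n] by blast
      then obtain z where z: "z \<in> car (N (Suc n))" "d n x = \<phi> n (d n z)"
        using N'(5)[of n] by (metis imageE)
      hence "d n (x - \<phi> (Suc n) z) = 0"
        using x \<phi>d hom_in_car[OF \<phi>] by (simp add: hom_diff[OF lm N'(3)])
      thus "\<exists>y\<in>car (N (Suc n)). x - \<phi> (Suc n) y \<in> syzygy N d e (Suc n)"
        using z x hom_in_car[OF \<phi>] diff_in_car[OF lm] by (auto simp: kernel_def)
    qed
  qed
qed

text \<open>The surjective endomorphism of \<open>N n\<close> that comes from chain maps \<open>N \<rightarrow> P \<rightarrow> N\<close> over the identity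
  factors through \<open>P n\<close>.\<close>

lemma minimal_resolution_zero:
  assumes M: "fd_module M" and N: "minimal_projective_resolution M N d e"
    and P: "projective_resolution M P d' e'" and z: "car (P n) = {0}"
  shows "car (N n) = {0}"
proof -
  have res: "projective_resolution M N d e" using N by (simp add: minimal_projective_resolution_def)
  note lmM = fd_left_module[OF M]
  note N' = projective_resolutionD[OF res] and P' = projective_resolutionD[OF P]
  obtain f where f: "\<And>n. f n \<in> module_hom (N n) (P n)" "\<And>x. x \<in> car (N 0) \<Longrightarrow> e' (f 0 x) = e x"
    "\<And>n x. x \<in> car (N (Suc n)) \<Longrightarrow> d' n (f (Suc n) x) = f n (d n x)"
    using comparison_chain_map[OF lmM res P] by blast
  obtain g where g: "\<And>n. g n \<in> module_hom (P n) (N n)" "\<And>x. x \<in> car (P 0) \<Longrightarrow> e (g 0 x) = e' x"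
    "\<And>n x. x \<in> car (P (Suc n)) \<Longrightarrow> d n (g (Suc n) x) = g n (d' n x)"
    using comparison_chain_map[OF lmM P res] by blast
  have "(\<lambda>x. g n (f n x)) ` car (N n) = car (N n)"
    by (rule minimal_resolution_endo_surjective[OF M N, of "\<lambda>n x. g n (f n x)"])
      (use f g hom_in_car[OF f(1)] in \<open>auto intro: hom_compose[OF f(1) g(1)]\<close>)
  moreover have "g n (f n x) = 0" if "x \<in> car (N n)" for x
    using hom_in_car[OF f(1) that] z hom_zero[OF projective_left_module[OF P'(1)] g(1)] by auto
  moreover have "0 \<in> car (N n)" by (rule zero_in_car[OF projective_left_module[OF N'(1)]])
  ultimately show ?thesis by auto
qed

lemma Inf_enat_mem: "A \<noteq> {} \<Longrightarrow> Inf A \<in> (A :: enat set)"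
  unfolding Inf_enat_def by (metis LeastI ex_in_conv)

lemma proj_dim_attained:
  assumes "proj_dim M < \<infinity>"
  obtains P d e where "projective_resolution M P d e" "\<forall>i. proj_dim M < enat i \<longrightarrow> car (P i) = {0}"
proof -
  let ?S = "{enat n | n. \<exists>P d e. projective_resolution M P d e \<and> (\<forall>i>n. car (P i) = {0})}"
  have "?S \<noteq> {}"
  proof
    assume "?S = {}"
    hence "proj_dim M = Inf {}" by (simp only: proj_dim_def)
    hence "proj_dim M = \<infinity>" by (simp add: Inf_enat_def)
    thus False using assms by simp
  qed
  hence "Inf ?S \<in> ?S" by (rule Inf_enat_mem)
  hence "proj_dim M \<in> ?S" by (simp only: proj_dim_def)
  then obtain n P d e where "proj_dim M = enat n" "projective_resolution M P d e"
    "\<forall>i>n. car (P i) = {0}"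
    by blast
  thus thesis using that by auto
qed

lemma proj_dim_le:
  "projective_resolution M P d e \<Longrightarrow> (\<And>i. i > n \<Longrightarrow> car (P i) = {0}) \<Longrightarrow> proj_dim M \<le> enat n"
  unfolding proj_dim_def by (rule Inf_lower) blast

text \<open>Comparison with a shortest resolution shows that \<open>N\<close> stops at \<open>m\<close>. It does not stop earlier, as
  it would then itself be a shorter resolution.\<close>

lemma minimal_resolution_top:
  assumes M: "fd_module M" and N: "minimal_projective_resolution M N d e"
    and m: "proj_dim M = enat m" "m > 0"
  shows "car (N m) \<noteq> {0}" and "i > m \<Longrightarrow> car (N i) = {0}"
proof -
  have res: "projective_resolution M N d e" using N by (simp add: minimal_projective_resolution_def)
  obtain P d' e' where P: "projective_resolution M P d' e'" "\<forall>i>m. car (P i) = {0}"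
    using proj_dim_attained[of M] m by auto
  show above: "car (N i) = {0}" if "i > m" for i
    using minimal_resolution_zero[OF M N P(1)] P(2) that by blast
  show "car (N m) \<noteq> {0}"
  proof
    assume "car (N m) = {0}"
    hence "car (N i) = {0}" if "i > m - 1" for i
      using above[of i] that by (cases "i = m") auto
    hence "proj_dim M \<le> enat (m - 1)" by (rule proj_dim_le[OF res])
    thus False using m by simp
  qed
qed

lemma proj_dim_zero_module:
  assumes M: "left_module (M :: 'a::complex_algebra_1 amod)" and z: "car M = {0}"
  shows "proj_dim M = 0"
proof -
  have "projective M"
    unfolding projective_def
  proof (intro conjI M allI impI, elim conjE)
    fix N N' :: "'a amod" and g f
    assume N: "left_module N" "left_module N'" and g: "g \<in> module_hom N N'" and f: "f \<in> module_hom M N'"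
    show "\<exists>h\<in>module_hom M N. \<forall>x\<in>car M. g (h x) = f x"
      using hom_zero[OF N(1) g] hom_zero[OF M f] zero_in_car[OF N(1)] act_zero_right[OF N(1)]
      by (intro bexI[of _ "\<lambda>x. 0"]) (auto simp: z module_hom_def)
  qed
  hence "projective_resolution M (\<lambda>_. M) (\<lambda>_ x. x) (\<lambda>x. x)"
    by (auto simp: projective_resolution_def kernel_def module_hom_def z)
  hence "proj_dim M \<le> enat 0" by (rule proj_dim_le) (rule z)
  thus ?thesis by (simp add: zero_enat_def[symmetric])
qed


section \<open>Integral profiles\<close>

text \<open>The reflection \<open>x \<mapsto> t - x\<close> preserves the box and its volume, so the integral \<open>I\<close> satisfies
  \<open>I = v g t - I\<close>, where \<open>v\<close> is the volume.\<close>

lemma integral_linear_cbox: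
  fixes g :: "real ^ 'd \<Rightarrow> complex"
  assumes g: "bounded_linear g"
  shows "integral\<^sup>L (lebesgue_on (cbox 0 t)) g = (measure lborel (cbox 0 t) / 2) *\<^sub>R g t"
proof -
  interpret bounded_linear g by (rule g)
  have cont: "continuous_on (cbox 0 t) g" by (rule continuous_on) (rule continuous_on_id)
  have int: "integrable (lebesgue_on (cbox 0 t)) g"
    by (rule continuous_imp_integrable[OF cont])
  define I where "I = integral (cbox 0 t) g"
  have I: "(g has_integral I) (cbox 0 t)"
    unfolding I_def by (rule integrable_integral[OF integrable_continuous[OF cont]])
  have "((\<lambda>x. g (- 1 *\<^sub>R x + t)) has_integral I) ((\<lambda>x. - 1 *\<^sub>R x + t) ` cbox 0 t)"
    using has_integral_affinity[OF I, of "-1" t] by simp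
  moreover have "(\<lambda>x. - 1 *\<^sub>R x + t) ` cbox 0 t = cbox 0 t"
  proof
    show "cbox 0 t \<subseteq> (\<lambda>x. - 1 *\<^sub>R x + t) ` cbox 0 t"
      by (rule subsetI, rule_tac x = "t - x" in image_eqI) (auto simp: mem_box_cart)
  qed (auto simp: mem_box_cart)
  ultimately have "((\<lambda>x. g t - g x) has_integral I) (cbox 0 t)"
    by (simp add: diff)
  moreover have "((\<lambda>x. g t - g x) has_integral measure lborel (cbox 0 t) *\<^sub>R g t - I) (cbox 0 t)"
    by (intro has_integral_diff has_integral_const I)
  ultimately have "I = measure lborel (cbox 0 t) *\<^sub>R g t - I" by (rule has_integral_unique)
  hence "2 *\<^sub>R I = measure lborel (cbox 0 t) *\<^sub>R g t" by (simp add: scaleR_2 eq_diff_eq)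
  hence "I = (1 / 2) *\<^sub>R (measure lborel (cbox 0 t) *\<^sub>R g t)"
    by (subst (asm) eq_commute) simp
  thus ?thesis using lebesgue_integral_eq_integral[OF int] by (simp add: I_def)
qed

text \<open>Injectivity is what makes the transport of Lebesgue measure to the span of the basis meaningful:
  integrals over \<open>box_measure\<close> become integrals over the box.\<close>

lemma inj_lincomb:
  fixes a :: "'d::finite \<Rightarrow> 'a::complex_algebra_1"
  assumes a: "algebra_basis a"
  shows "inj (lincomb a)"
proof (rule injI)
  fix l l' assume eq: "lincomb a l = lincomb a l'"
  have inj: "inj a" and ind: "cvs.independent (range a)" using a by (auto simp: algebra_basis_def)
  define u where "u v = complex_of_real (l $ inv a v - l' $ inv a v)" for v
  have "(\<Sum>v\<in>range a. u v *\<^sub>C v) = (\<Sum>i\<in>UNIV. complex_of_real (l $ i - l' $ i) *\<^sub>C a i)"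
    using inj by (simp add: sum.reindex u_def)
  also have "\<dots> = lincomb a l - lincomb a l'"
    by (simp add: lincomb_def cvs.scale_left_diff_distrib sum_subtractf)
  finally have "(\<Sum>v\<in>range a. u v *\<^sub>C v) = 0" using eq by simp
  hence "\<forall>v\<in>range a. u v = 0"
    using ind cvs.dependent_finite[of "range a"] by auto
  thus "l = l'" using inj by (simp add: u_def vec_eq_iff)
qed

lemma integral_box_measure:
  fixes a :: "'d::finite \<Rightarrow> 'a::complex_algebra_1" and h :: "'a \<Rightarrow> complex"
  assumes a: "algebra_basis a" and h: "bounded_linear (\<lambda>l. h (lincomb a l))"
  shows "(LINT r | box_measure a t. h r) =
    (measure lborel (cbox 0 (vec_of t)) / 2) *\<^sub>R h (lincomb a (vec_of t))"
proof -
  let ?M = "lebesgue_on (cbox 0 (vec_of t))"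
  have "(\<lambda>l. h (lincomb a l)) \<in> borel_measurable borel"
    by (rule borel_measurable_continuous_onI[OF bounded_linear.continuous_on[OF h continuous_on_id]])
  hence m: "(\<lambda>l. h (lincomb a l)) \<in> borel_measurable ?M"
    by (intro measurable_restrict_space1 measurable_completion) simp
  hence hm: "h \<in> borel_measurable (embed_measure ?M (lincomb a))"
    by (rule measurable_embed_measure1)
  have "(LINT r | box_measure a t. h r) =
    (LINT r | distr ?M (embed_measure ?M (lincomb a)) (lincomb a). h r)"
    unfolding box_measure_def by (subst embed_measure_eq_distr[OF inj_lincomb[OF a]]) simp
  also have "\<dots> = (LINT l | ?M. h (lincomb a l))"
    by (rule integral_distr[OF measurable_embed_measure2[OF inj_lincomb[OF a]] hm])
  also have "\<dots> = (measure lborel (cbox 0 (vec_of t)) / 2) *\<^sub>R h (lincomb a (vec_of t))"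
    by (rule integral_linear_cbox[OF h])
  finally show ?thesis .
qed

text \<open>Each matrix entry of the structure map is a linear function on the box, so its integral is known.
  The matrix so obtained is reassembled into the action of a single algebra element, which also shows
  that the choice of the basis \<open>B\<close> is immaterial.\<close>

lemma profile_eq:
  fixes a :: "'d::finite \<Rightarrow> 'a::complex_algebra_1" and M :: "('a, 'v::ab_group_add) lmodule"
  assumes a: "algebra_basis a" and M: "fd_module M" and x: "x \<in> car M"
  shows "profile a M t x =
    cscale M (of_real (measure lborel (cbox 0 (vec_of t)) / 2)) (act M (lincomb a (vec_of t)) x)"
proof -
  note lm = fd_left_module[OF M]
  define B where "B = (SOME B. finite_cbasis M B)"
  have B: "finite_cbasis M B" unfolding B_def using M by (auto simp: fd_module_def intro: someI)
  hence BM: "B \<subseteq> car M" and fB: "finite B" by (auto simp: finite_cbasis_def)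
  define v where "v = complex_of_real (measure lborel (cbox 0 (vec_of t)) / 2)"
  let ?r = "lincomb a (vec_of t)"
  have cm: "coordinate_map M B (coords M B)" by (rule coordinate_map_coords[OF lm B])
  have coords_sum: "coords M B (\<Sum>i\<in>J. cscale M (c i) (y i)) = (\<lambda>b. \<Sum>i\<in>J. c i * coords M B (y i) b)"
    if "finite J" "\<And>i. i \<in> J \<Longrightarrow> y i \<in> car M" for J :: "'d set" and c y
    using that
  proof (induction J rule: finite_induct)
    case empty
    have "coords M B 0 = coords M B 0 + coords M B 0"
      using cm zero_in_car[OF lm] unfolding coordinate_map_def by (metis add_0)
    thus ?case by (simp add: fun_eq_iff)
  next
    case (insert i J)
    have "cscale M (c i) (y i) \<in> car M" "(\<Sum>i\<in>J. cscale M (c i) (y i)) \<in> car M"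
      using insert.prems by (auto intro!: sum_in_car[OF lm] cscale_in_car[OF lm])
    thus ?case using insert cm unfolding coordinate_map_def by (simp add: fun_eq_iff)
  qed
  have entry: "(LINT r | box_measure a t. coords M B (act M r b') b) = v * coords M B (act M ?r b') b"
    if b': "b' \<in> B" for b b'
  proof -
    have b'M: "b' \<in> car M" using b' BM by blast
    have eq: "(\<lambda>l. coords M B (act M (lincomb a l) b') b) =
          (\<lambda>l. \<Sum>i\<in>UNIV. complex_of_real (l $ i) * coords M B (act M (a i) b') b)"
      by (simp add: lincomb_def act_sum_left[OF lm b'M] act_scaleC[OF lm b'M]
          coords_sum act_in_car[OF lm b'M])
    have "bounded_linear (\<lambda>l. coords M B (act M (lincomb a l) b') b)"
      unfolding eq by (intro bounded_linear_sum bounded_linear_compose[OF bounded_linear_mult_left]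
          bounded_linear_compose[OF bounded_linear_of_real] bounded_linear_vec_nth)
    from integral_box_measure[OF a this, of t] show ?thesis
      by (simp add: v_def scaleR_conv_of_real)
  qed
  have "profile a M t x = (\<Sum>b'\<in>B. \<Sum>b\<in>B. cscale M (coords M B x b' * (v * coords M B (act M ?r b') b)) b)"
    using x entry by (simp add: profile_def B_def[symmetric] Let_def)
  also have "\<dots> = (\<Sum>b'\<in>B. cscale M (v * coords M B x b') (act M ?r b'))"
  proof (rule sum.cong[OF refl])
    fix b' assume "b' \<in> B"
    hence rb: "act M ?r b' \<in> car M" using BM act_in_car[OF lm] by blast
    have "(\<Sum>b\<in>B. cscale M (coords M B x b' * (v * coords M B (act M ?r b') b)) b) =
          (\<Sum>b\<in>B. cscale M (v * coords M B x b') (cscale M (coords M B (act M ?r b') b) b))"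
      using BM by (intro sum.cong) (auto simp: cscale_cscale[OF lm] subset_iff mult_ac)
    also have "\<dots> = cscale M (v * coords M B x b') (\<Sum>b\<in>B. cscale M (coords M B (act M ?r b') b) b)"
      using BM by (intro cscale_sum_right[OF lm, symmetric] cscale_in_car[OF lm]) blast
    also have "(\<Sum>b\<in>B. cscale M (coords M B (act M ?r b') b) b) = act M ?r b'"
      using is_coords_coords[OF B rb] by (simp add: is_coords_def)
    finally show "(\<Sum>b\<in>B. cscale M (coords M B x b' * (v * coords M B (act M ?r b') b)) b) =
      cscale M (v * coords M B x b') (act M ?r b')" .
  qed
  also have "\<dots> = (\<Sum>b'\<in>B. cscale M v (act M ?r (cscale M (coords M B x b') b')))"
    using BM by (intro sum.cong)
      (auto simp: act_cscale[OF lm] cscale_cscale[OF lm] act_in_car[OF lm] subset_iff)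
  also have "\<dots> = cscale M v (\<Sum>b'\<in>B. act M ?r (cscale M (coords M B x b') b'))"
    using BM by (intro cscale_sum_right[OF lm, symmetric] cscale_in_car[OF lm] act_in_car[OF lm]) blast
  also have "(\<Sum>b'\<in>B. act M ?r (cscale M (coords M B x b') b')) =
      act M ?r (\<Sum>b'\<in>B. cscale M (coords M B x b') b')"
    using BM by (intro act_sum_right[OF lm, symmetric] cscale_in_car[OF lm]) blast
  also have "(\<Sum>b'\<in>B. cscale M (coords M B x b') b') = x"
    using is_coords_coords[OF B x] by (simp add: is_coords_def)
  finally show ?thesis by (simp add: v_def)
qed

lemma profile_in_car:
  fixes a :: "'d::finite \<Rightarrow> 'a::complex_algebra_1" and M :: "('a, 'v::ab_group_add) lmodule"
  assumes "algebra_basis a" "fd_module M" "x \<in> car M"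
  shows "profile a M t x \<in> car M"
  unfolding profile_eq[OF assms]
  using assms fd_left_module by (blast intro: cscale_in_car act_in_car)

lemma profile_zero:
  fixes a :: "'d::finite \<Rightarrow> 'a::complex_algebra_1" and M :: "('a, 'v::ab_group_add) lmodule"
  assumes a: "algebra_basis a" and M: "fd_module M"
  shows "profile a M t 0 = 0"
proof -
  note lm = fd_left_module[OF M]
  show ?thesis
    by (simp add: profile_eq[OF a M zero_in_car[OF lm]] act_zero_right[OF lm] cscale_zero_right[OF lm])
qed

text \<open>If all profiles killed \<open>x\<close>, then so would every \<open>lincomb a l\<close> with \<open>l\<close> positive. The differences of
  such elements contain all basis vectors, hence the unit of the algebra would kill \<open>x\<close> as well.\<close>

lemma profile_nonzero:
  fixes a :: "'d::finite \<Rightarrow> 'a::complex_algebra_1" and M :: "('a, 'v::ab_group_add) lmodule"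
  assumes a: "algebra_basis a" and M: "fd_module M" and x: "x \<in> car M" "x \<noteq> 0"
  shows "\<exists>t. profile a M t x \<noteq> 0"
proof (rule ccontr)
  assume "\<not> ?thesis"
  hence zero: "profile a M t x = 0" for t by blast
  note lm = fd_left_module[OF M]
  have rv: "act M (lincomb a l) x = 0" if l: "\<forall>i. 0 < l $ i" for l
  proof -
    have vec: "vec_of (orthant_of l) = l"
      by (rule orthant_of_inverse) (use l in \<open>auto intro: less_imp_le\<close>)
    have "measure lborel (cbox 0 l) > 0"
      using l by (intro content_pos_lt) (auto simp: Basis_vec_def inner_axis)
    hence "act M (lincomb a l) x = 0"
      using zero[of "orthant_of l"] act_in_car[OF lm x(1)]
      by (simp add: profile_eq[OF a M x(1)] vec cscale_eq_0_iff[OF lm])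
    thus ?thesis .
  qed
  have "act M (a i) x = 0" for i
  proof -
    \<comment> \<open>both \<open>1\<close> and \<open>1 + axis i 1\<close> have positive coordinates only, so the boxes have positive volume\<close>
    have "lincomb a (1 + axis i 1) = lincomb a 1 + a i"
    proof -
      have "complex_of_real (axis i 1 $ j) *\<^sub>C a j = (if j = i then a j else 0)" for j
        by (simp add: axis_def scaleC_one)
      thus ?thesis by (simp add: lincomb_def scaleC_left_distrib sum.distrib)
    qed
    hence "act M (lincomb a (1 + axis i 1)) x = act M (lincomb a 1) x + act M (a i) x"
      by (simp add: act_add_left[OF lm x(1)])
    moreover have "act M (lincomb a (1 + axis i 1)) x = 0" by (rule rv) (simp add: axis_def)
    moreover have "act M (lincomb a 1) x = 0" by (rule rv) simp
    ultimately show ?thesis by simp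
  qed
  moreover have "1 \<in> cvs.span (range a)" using a by (simp add: algebra_basis_def)
  hence "act M 1 x = 0"
  proof (induction rule: cvs.span_induct_alt)
    case base
    show ?case by (rule act_zero_left[OF lm x(1)])
  next
    case (step c b r)
    thus ?case
      using \<open>\<And>i. act M (a i) x = 0\<close>
      by (auto simp: act_add_left[OF lm x(1)] act_scaleC[OF lm x(1)] cscale_zero_right[OF lm])
  qed
  ultimately show False using act_one[OF lm x(1)] x(2) by simp
qed


section \<open>Direct sums\<close>

lemma left_module_dsum2:
  "left_module M \<Longrightarrow> left_module N \<Longrightarrow> left_module (dsum2 M N)"
  unfolding left_module_def dsum2_def by (auto simp: zero_prod_def)

lemma left_module_dsum:
  assumes M: "\<And>i. i \<in> J \<Longrightarrow> left_module (M i)"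
  shows "left_module (dsum J M)"
  unfolding left_module_def
proof (intro conjI ballI allI)
  show "0 \<in> car (dsum J M)" using zero_in_car[OF M] by (simp add: dsum_def)
next
  fix x y assume x: "x \<in> car (dsum J M)" and y: "y \<in> car (dsum J M)"
  hence "finite ({i. x i \<noteq> 0} \<union> {i. y i \<noteq> 0})" by (simp add: dsum_def)
  hence "finite {i. (x + y) i \<noteq> 0}" by (rule rev_finite_subset) auto
  thus "x + y \<in> car (dsum J M)" using x y add_in_car[OF M] by (simp add: dsum_def)
  show "act (dsum J M) r (x + y) = act (dsum J M) r x + act (dsum J M) r y" for r
    using x y act_add_right[OF M] by (auto simp: dsum_def fun_eq_iff)
next
  fix x assume x: "x \<in> car (dsum J M)"
  show "- x \<in> car (dsum J M)" using x minus_in_car[OF M] by (simp add: dsum_def)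
  show "act (dsum J M) 1 x = x" using x act_one[OF M] by (auto simp: dsum_def fun_eq_iff)
  fix r
  have "finite {i. x i \<noteq> 0}" using x by (simp add: dsum_def)
  hence "finite {i. act (dsum J M) r x i \<noteq> 0}"
    by (rule rev_finite_subset) (auto simp: dsum_def act_zero_right[OF M] split: if_splits)
  thus "act (dsum J M) r x \<in> car (dsum J M)"
    using x act_in_car[OF M] by (simp add: dsum_def)
  fix q
  show "act (dsum J M) (r + q) x = act (dsum J M) r x + act (dsum J M) q x"
    using x act_add_left[OF M] by (auto simp: dsum_def fun_eq_iff)
  show "act (dsum J M) (r * q) x = act (dsum J M) r (act (dsum J M) q x)"
    using x act_mult[OF M] by (auto simp: dsum_def fun_eq_iff)
qed

lemma iso_dsum_single:
  assumes f: "f \<in> module_iso M (N j)" and lm: "left_module M"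
  shows "(\<lambda>x i. if i = j then f x else 0) \<in> module_iso M (dsum {j} N)"
proof -
  have h: "f \<in> module_hom M (N j)" and b: "bij_betw f (car M) (car (N j))"
    using f by (auto simp: module_iso_def)
  let ?F = "\<lambda>x i. if i = j then f x else 0"
  have "?F \<in> module_hom M (dsum {j} N)"
    using hom_in_car[OF h] hom_add[OF h] hom_act[OF h]
    by (auto simp: module_hom_def dsum_def fun_eq_iff)
  moreover have "inj_on ?F (car M)"
  proof (rule inj_onI)
    fix x y assume "x \<in> car M" "y \<in> car M" "?F x = ?F y"
    thus "x = y" using fun_cong[of "?F x" "?F y" j] b by (auto simp: bij_betw_def dest: inj_onD)
  qed
  moreover have "y \<in> ?F ` car M" if y: "y \<in> car (dsum {j} N)" for y
  proof -
    have "y j \<in> f ` car M" using y b by (simp add: dsum_def bij_betw_def)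
    then obtain x where "x \<in> car M" "f x = y j" by auto
    thus ?thesis using y by (intro image_eqI[of _ _ x]) (auto simp: dsum_def fun_eq_iff)
  qed
  ultimately show ?thesis using hom_in_car[of ?F M "dsum {j} N"] by (auto simp: module_iso_def bij_betw_def)
qed

lemma isomorphic_zero_iff:
  assumes M: "left_module M" and N: "left_module N" and iso: "isomorphic M N"
  shows "car M = {0} \<longleftrightarrow> car N = {0}"
proof -
  obtain f where f: "f \<in> module_hom M N" and b: "bij_betw f (car M) (car N)"
    using iso by (auto simp: isomorphic_def module_iso_def)
  have im: "f ` car M = car N" and inj: "inj_on f (car M)" using b by (auto simp: bij_betw_def)
  show ?thesis
  proof
    assume "car M = {0}"
    thus "car N = {0}" using im hom_zero[OF M f] by auto
  next
    assume "car N = {0}"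
    hence "f x = f 0" if "x \<in> car M" for x using that im hom_zero[OF M f] by auto
    thus "car M = {0}" using inj zero_in_car[OF M] by (auto dest: inj_onD)
  qed
qed

lemma isomorphic_sym: "left_module M \<Longrightarrow> isomorphic M N \<Longrightarrow> isomorphic N M"
  using iso_inverse by (auto simp: isomorphic_def)

lemma projective_in_CA:
  assumes "fd_module M" "projective M"
  shows "in_CA M"
proof -
  have "(\<lambda>x. x) \<in> module_iso M M" by (simp add: module_iso_def module_hom_def bij_betw_def inj_on_def)
  hence "isomorphic M (dsum {0::nat} (\<lambda>_. M))"
    using iso_dsum_single[of "\<lambda>x. x" M "\<lambda>_. M" "0::nat"] fd_left_module[OF assms(1)]
    by (auto simp: isomorphic_def)
  moreover have "{..<1} = {0::nat}" by auto
  ultimately show ?thesis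
    unfolding in_CA_def using assms by (intro conjI exI[of _ "1::nat"] exI[of _ "\<lambda>_. M"]) auto
qed


section \<open>Decomposition of projective modules\<close>

text \<open>The component in \<open>N\<close> is unique because \<open>N\<close> and \<open>N'\<close> meet in \<open>0\<close>; uniqueness turns the choice of a
  component into a homomorphism.\<close>

lemma complement_projection:
  assumes P: "left_module P" and N: "submodule P N" and N': "submodule P N'"
    and int: "N \<inter> N' = {0}" and sum: "{x + y | x y. x \<in> N \<and> y \<in> N'} = car P"
  obtains \<pi> where "\<pi> \<in> module_hom P (P\<lparr>car := N\<rparr>)" "(\<lambda>x. x - \<pi> x) \<in> module_hom P (P\<lparr>car := N'\<rparr>)"
    "\<And>x y. x \<in> N \<Longrightarrow> y \<in> N' \<Longrightarrow> \<pi> (x + y) = x"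
proof -
  note lmN = submodule_left_module[OF P N] and lmN' = submodule_left_module[OF P N']
  have NP: "N \<subseteq> car P" "N' \<subseteq> car P" using N N' by (auto simp: submodule_def)
  define \<pi> where "\<pi> z = (SOME x. x \<in> N \<and> z - x \<in> N')" for z
  have uniq: "x = x'" if "x \<in> N" "x' \<in> N" "z - x \<in> N'" "z - x' \<in> N'" for x x' z
  proof -
    have "x - x' \<in> N" using diff_in_car[OF lmN] that by simp
    moreover have "(z - x') - (z - x) \<in> car (P\<lparr>car := N'\<rparr>)"
      by (rule diff_in_car[OF lmN']) (use that in simp_all)
    ultimately have "x - x' \<in> N \<inter> N'" by simp
    thus ?thesis using int by simp
  qed
  have ex: "\<exists>x. x \<in> N \<and> z - x \<in> N'" if z: "z \<in> car P" for z
  proof -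
    obtain x y where "z = x + y" "x \<in> N" "y \<in> N'" using z sum by blast
    thus ?thesis by (intro exI[of _ x]) simp
  qed
  have \<pi>: "\<pi> z \<in> N" "z - \<pi> z \<in> N'" if "z \<in> car P" for z
    using someI_ex[OF ex[OF that]] by (auto simp: \<pi>_def)
  have \<pi>_add: "\<pi> (x + y) = \<pi> x + \<pi> y" if xy: "x \<in> car P" "y \<in> car P" for x y
  proof (rule uniq[of _ _ "x + y"])
    show "\<pi> x + \<pi> y \<in> N" using add_in_car[OF lmN] \<pi> xy by simp
    have "(x - \<pi> x) + (y - \<pi> y) \<in> N'" using add_in_car[OF lmN'] \<pi> xy by simp
    thus "x + y - (\<pi> x + \<pi> y) \<in> N'" by (simp add: algebra_simps)
  qed (use xy \<pi> add_in_car[OF P] in auto)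
  have \<pi>_act: "\<pi> (act P r x) = act P r (\<pi> x)" if x: "x \<in> car P" for r x
  proof (rule uniq[of _ _ "act P r x"])
    show "act P r (\<pi> x) \<in> N" using act_in_car[OF lmN, of "\<pi> x" r] \<pi> x by simp
    have px: "\<pi> x \<in> car P" using \<pi> x NP by blast
    have "act P r (x - \<pi> x) \<in> N'" using act_in_car[OF lmN', of "x - \<pi> x" r] \<pi> x by simp
    moreover have "act P r (x - \<pi> x) = act P r x - act P r (\<pi> x)"
      using act_add_right[OF P x minus_in_car[OF P px], of r] act_minus_right[OF P px] by simp
    ultimately show "act P r x - act P r (\<pi> x) \<in> N'" by simp
  qed (use x \<pi> act_in_car[OF P] in auto)
  show thesis
  proof (rule that[of \<pi>])
    show "\<pi> \<in> module_hom P (P\<lparr>car := N\<rparr>)"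
      using \<pi> \<pi>_add \<pi>_act by (simp add: module_hom_def)
    have "act P r x - act P r (\<pi> x) = act P r (x - \<pi> x)" if x: "x \<in> car P" for r x
    proof -
      have px: "\<pi> x \<in> car P" using \<pi> x NP by blast
      show ?thesis
        using act_add_right[OF P x minus_in_car[OF P px], of r] act_minus_right[OF P px] by simp
    qed
    thus "(\<lambda>x. x - \<pi> x) \<in> module_hom P (P\<lparr>car := N'\<rparr>)"
      using \<pi> \<pi>_add \<pi>_act by (simp add: module_hom_def)
    show "\<pi> (x + y) = x" if "x \<in> N" "y \<in> N'" for x y
      using that \<pi>[of "x + y"] add_in_car[OF P, of x y] NP
      by (intro uniq[of _ _ "x + y"]) auto
  qed
qed

lemma dsumD:
  assumes "x \<in> car (dsum J M)"
  shows "i \<in> J \<Longrightarrow> x i \<in> car (M i)" "i \<notin> J \<Longrightarrow> x i = 0" "finite {i. x i \<noteq> 0}"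
  using assms by (auto simp: dsum_def)

text \<open>Of the \<open>m X + m' X\<close> copies of \<open>X\<close>, the first \<open>m X\<close> receive the summand \<open>N\<close> and the others the summand
  \<open>N'\<close>, with the index shifted by \<open>m X\<close>. Copies are numbered from \<open>1\<close>, so \<open>r \<le> m X\<close> separates the
  two groups and index \<open>0\<close> carries the value \<open>0\<close> on both sides.\<close>

lemma isomorphic_copies_add:
  fixes P :: "('a::complex_algebra_1, 'v::ab_group_add) lmodule"
    and \<Q> :: "('a, 'w::ab_group_add) lmodule set"
  assumes P: "left_module P" and N: "submodule P N" and N': "submodule P N'"
    and int: "N \<inter> N' = {0}" and sum: "{x + y | x y. x \<in> N \<and> y \<in> N'} = car P"
    and iso: "isomorphic (P\<lparr>car := N\<rparr>) (dsum (copies \<Q> m) fst)"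
    and iso': "isomorphic (P\<lparr>car := N'\<rparr>) (dsum (copies \<Q> m') fst)"
  shows "isomorphic P (dsum (copies \<Q> (\<lambda>X. m X + m' X)) fst)"
proof -
  let ?D = "dsum (copies \<Q> m) fst" and ?D' = "dsum (copies \<Q> m') fst"
  let ?E = "dsum (copies \<Q> (\<lambda>X. m X + m' X)) fst"
  note lmN = submodule_left_module[OF P N] and lmN' = submodule_left_module[OF P N']
  have NP: "N \<subseteq> car P" "N' \<subseteq> car P" using N N' by (auto simp: submodule_def)
  obtain \<pi> where \<pi>: "\<pi> \<in> module_hom P (P\<lparr>car := N\<rparr>)"
    and \<pi>': "(\<lambda>x. x - \<pi> x) \<in> module_hom P (P\<lparr>car := N'\<rparr>)"
    and \<pi>_add: "\<And>x y. x \<in> N \<Longrightarrow> y \<in> N' \<Longrightarrow> \<pi> (x + y) = x"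
    by (rule complement_projection[OF P N N' int sum]) (rule that)
  obtain f where f: "f \<in> module_hom (P\<lparr>car := N\<rparr>) ?D" and bf: "bij_betw f N (car ?D)"
    using iso by (auto simp: isomorphic_def module_iso_def)
  obtain f' where f': "f' \<in> module_hom (P\<lparr>car := N'\<rparr>) ?D'" and bf': "bij_betw f' N' (car ?D')"
    using iso' by (auto simp: isomorphic_def module_iso_def)
  define g where "g = (\<lambda>x. f (\<pi> x))"
  define g' where "g' = (\<lambda>x. f' (x - \<pi> x))"
  have g: "g \<in> module_hom P ?D" unfolding g_def by (rule hom_compose[OF \<pi> f])
  have g': "g' \<in> module_hom P ?D'" unfolding g'_def by (rule hom_compose[OF \<pi>' f'])
  define F where "F x = (\<lambda>(X, r). if r \<le> m X then g x (X, r) else g' x (X, r - m X))" for x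
  have in_m: "(X, r) \<in> copies \<Q> (\<lambda>X. m X + m' X) \<longleftrightarrow> (X, r) \<in> copies \<Q> m" if "r \<le> m X" for X r
    using that by (auto simp: copies_def)
  have in_m': "(X, r) \<in> copies \<Q> (\<lambda>X. m X + m' X) \<longleftrightarrow> (X, r - m X) \<in> copies \<Q> m'" if "\<not> r \<le> m X" for X r
    using that by (auto simp: copies_def)
  have out_m: "(X, r) \<notin> copies \<Q> m" if "\<not> r \<le> m X" for X r using that by (simp add: copies_def)
  have out_0: "(X, 0) \<notin> copies \<Q> m''" for X m'' by (simp add: copies_def)
  have homF: "F \<in> module_hom P ?E"
    unfolding module_hom_def
  proof (intro CollectI conjI ballI allI)
    fix x assume x: "x \<in> car P"
    note gx = hom_in_car[OF g x] and gx' = hom_in_car[OF g' x]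
    have "{i. F x i \<noteq> 0} \<subseteq> {i. g x i \<noteq> 0} \<union> (\<lambda>(X, r). (X, r + m X)) ` {i. g' x i \<noteq> 0}"
    proof
      fix i assume i: "i \<in> {i. F x i \<noteq> 0}"
      obtain X r where Xr: "i = (X, r)" by (cases i)
      show "i \<in> {i. g x i \<noteq> 0} \<union> (\<lambda>(X, r). (X, r + m X)) ` {i. g' x i \<noteq> 0}"
      proof (cases "r \<le> m X")
        case True
        thus ?thesis using i by (simp add: Xr F_def)
      next
        case False
        thus ?thesis using i
          by (intro UnI2 image_eqI[of _ _ "(X, r - m X)"]) (auto simp: Xr F_def)
      qed
    qed
    hence fin: "finite {i. F x i \<noteq> 0}"
      by (rule finite_subset) (simp add: dsumD(3)[OF gx] dsumD(3)[OF gx'])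
    have "F x (X, r) \<in> car X" if "(X, r) \<in> copies \<Q> (\<lambda>X. m X + m' X)" for X r
      using that dsumD(1)[OF gx, of "(X, r)"] dsumD(1)[OF gx', of "(X, r - m X)"]
      by (cases "r \<le> m X") (auto simp: F_def in_m in_m')
    moreover have "F x (X, r) = 0" if "(X, r) \<notin> copies \<Q> (\<lambda>X. m X + m' X)" for X r
      using that dsumD(2)[OF gx, of "(X, r)"] dsumD(2)[OF gx', of "(X, r - m X)"]
      by (cases "r \<le> m X") (auto simp: F_def in_m in_m')
    ultimately show "F x \<in> car ?E" using fin by (auto simp: dsum_def)
    show "F (act P q x) = act ?E q (F x)" for q
    proof (rule ext)
      fix i :: "('a, 'w) lmodule \<times> nat"
      obtain X r where Xr: "i = (X, r)" by (cases i)
      show "F (act P q x) i = act ?E q (F x) i"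
        by (cases "r \<le> m X")
          (auto simp: Xr F_def hom_act[OF g x] hom_act[OF g' x] dsum_def in_m in_m')
    qed
  next
    fix x y assume "x \<in> car P" "y \<in> car P"
    thus "F (x + y) = F x + F y"
      by (simp add: F_def hom_add[OF g] hom_add[OF g'] fun_eq_iff)
  qed
  moreover have "inj_on F (car P)"
  proof (rule hom_inj_onI[OF P homF])
    fix x assume x: "x \<in> car P" and z: "F x = 0"
    note gx = hom_in_car[OF g x] and gx' = hom_in_car[OF g' x]
    have "g x (X, r) = 0" for X r
      using fun_cong[OF z, of "(X, r)"] dsumD(2)[OF gx, of "(X, r)"] out_m[of r X]
      by (cases "r \<le> m X") (auto simp: F_def)
    hence "f (\<pi> x) = f 0"
      by (simp add: g_def fun_eq_iff hom_zero[OF lmN f])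
    moreover have "\<pi> x \<in> N" using hom_in_car[OF \<pi> x] by simp
    ultimately have 1: "\<pi> x = 0"
      using bf zero_in_car[OF lmN] by (auto simp: bij_betw_def dest: inj_onD)
    have "g' x (X, r) = 0" for X r
      using fun_cong[OF z, of "(X, r + m X)"] dsumD(2)[OF gx' out_0[of X m']]
      by (cases "r = 0") (auto simp: F_def)
    hence "f' (x - \<pi> x) = f' 0"
      by (simp add: g'_def fun_eq_iff hom_zero[OF lmN' f'])
    moreover have "x - \<pi> x \<in> N'" using hom_in_car[OF \<pi>' x] by simp
    ultimately have "x - \<pi> x = 0"
      using bf' zero_in_car[OF lmN'] by (auto simp: bij_betw_def dest: inj_onD)
    thus "x = 0" using 1 by simp
  qed
  moreover have "y \<in> F ` car P" if y: "y \<in> car ?E" for y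
  proof -
    define y1 where "y1 = (\<lambda>(X, r). if r \<le> m X then y (X, r) else 0)"
    define y2 where "y2 = (\<lambda>(X, r). if 1 \<le> r then y (X, r + m X) else 0)"
    have fin: "finite {i. y i \<noteq> 0}" by (rule dsumD(3)[OF y])
    have "{i. y1 i \<noteq> 0} \<subseteq> {i. y i \<noteq> 0}" by (auto simp: y1_def split: if_splits)
    hence fin1: "finite {i. y1 i \<noteq> 0}" using fin finite_subset by blast
    have "{i. y2 i \<noteq> 0} \<subseteq> (\<lambda>(X, r). (X, r - m X)) ` {i. y i \<noteq> 0}"
    proof
      fix i assume i: "i \<in> {i. y2 i \<noteq> 0}"
      obtain X r where Xr: "i = (X, r)" by (cases i)
      show "i \<in> (\<lambda>(X, r). (X, r - m X)) ` {i. y i \<noteq> 0}"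
        using i by (intro image_eqI[of _ _ "(X, r + m X)"]) (auto simp: Xr y2_def split: if_splits)
    qed
    hence fin2: "finite {i. y2 i \<noteq> 0}" using fin finite_surj by blast
    have "y1 (X, r) \<in> car X" if "(X, r) \<in> copies \<Q> m" for X r
      using that dsumD(1)[OF y, of "(X, r)"] by (auto simp: y1_def copies_def)
    moreover have "y1 (X, r) = 0" if "(X, r) \<notin> copies \<Q> m" for X r
      using that dsumD(2)[OF y, of "(X, r)"] in_m[of r X] by (auto simp: y1_def)
    ultimately have "y1 \<in> car ?D" using fin1 by (auto simp: dsum_def)
    hence "y1 \<in> f ` N" using bf by (simp add: bij_betw_def)
    then obtain u where u: "u \<in> N" "f u = y1" by blast
    have "y2 (X, r) \<in> car X" if "(X, r) \<in> copies \<Q> m'" for X r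
      using that dsumD(1)[OF y, of "(X, r + m X)"] by (auto simp: y2_def copies_def)
    moreover have "y2 (X, r) = 0" if "(X, r) \<notin> copies \<Q> m'" for X r
      using that dsumD(2)[OF y, of "(X, r + m X)"] by (auto simp: y2_def copies_def)
    ultimately have "y2 \<in> car ?D'" using fin2 by (auto simp: dsum_def)
    hence "y2 \<in> f' ` N'" using bf' by (simp add: bij_betw_def)
    then obtain v where v: "v \<in> N'" "f' v = y2" by blast
    have "\<pi> (u + v) = u" by (rule \<pi>_add[OF u(1) v(1)])
    hence "F (u + v) (X, r) = y (X, r)" for X r
      by (cases "r \<le> m X") (simp_all add: F_def g_def g'_def u v y1_def y2_def Suc_le_eq)
    hence "y = F (u + v)" by (simp add: fun_eq_iff)
    moreover have "u + v \<in> car P" using u v NP by (blast intro: add_in_car[OF P])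
    ultimately show ?thesis by blast
  qed
  ultimately have "F \<in> module_iso P ?E"
    using hom_in_car[OF homF] by (auto simp: module_iso_def bij_betw_def)
  thus ?thesis by (auto simp: isomorphic_def)
qed

text \<open>Induction on the dimension: a proper direct summand is smaller, and it is projective because it is
  a retract.\<close>

lemma projective_decomposition:
  fixes P :: "'a::complex_algebra_1 amod"
  assumes rep: "\<And>X. fd_module X \<Longrightarrow> indecomposable X \<Longrightarrow> projective X \<Longrightarrow> \<exists>Y\<in>\<Q>. isomorphic X Y"
    and P: "fd_module P" "projective P"
  shows "\<exists>m. (\<forall>X. X \<notin> \<Q> \<longrightarrow> m X = 0) \<and> isomorphic P (dsum (copies \<Q> m) fst)"
  using P
proof (induction "cdim P" arbitrary: P rule: less_induct)
  case less
  note lm = fd_left_module[OF less.prems(1)]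
  consider "car P = {0}" | "indecomposable P" | "car P \<noteq> {0}" "\<not> indecomposable P" by blast
  thus ?case
  proof cases
    case 1
    have "copies \<Q> (\<lambda>_. 0) = {}" by (auto simp: copies_def)
    hence "(\<lambda>x i. 0) \<in> module_iso P (dsum (copies \<Q> (\<lambda>_. 0)) fst)"
      by (auto simp: 1 module_iso_def module_hom_def dsum_def bij_betw_def fun_eq_iff)
    thus ?thesis by (intro exI[of _ "\<lambda>_. 0"]) (auto simp: isomorphic_def)
  next
    case 2
    then obtain Y where Y: "Y \<in> \<Q>" "isomorphic P Y" using rep less.prems by blast
    then obtain g where g: "g \<in> module_iso P Y" by (auto simp: isomorphic_def)
    define m where "m X = (if X = Y then 1 else 0 :: nat)" for X
    have "copies \<Q> m = {(Y, 1)}" using Y by (auto simp: copies_def m_def split: if_splits)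
    hence "isomorphic P (dsum (copies \<Q> m) fst)"
      using iso_dsum_single[of g P fst "(Y, 1::nat)"] g lm by (auto simp: isomorphic_def)
    thus ?thesis using Y by (intro exI[of _ m]) (auto simp: m_def)
  next
    case 3
    then obtain N N' where N: "submodule P N" "submodule P N'" "N \<inter> N' = {0}"
      "{x + y | x y. x \<in> N \<and> y \<in> N'} = car P" "N \<noteq> {0}" "N' \<noteq> {0}"
      unfolding indecomposable_def by blast
    have summand: "\<exists>m. (\<forall>X. X \<notin> \<Q> \<longrightarrow> m X = 0) \<and> isomorphic (P\<lparr>car := N\<rparr>) (dsum (copies \<Q> m) fst)"
      if N: "submodule P N" "submodule P N'" "N \<inter> N' = {0}"
        "{x + y | x y. x \<in> N \<and> y \<in> N'} = car P" "N' \<noteq> {0}" for N N'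
    proof (rule less.hyps)
      have NP: "N \<subseteq> car P" "N' \<subseteq> car P" using N by (auto simp: submodule_def)
      show fd: "fd_module (P\<lparr>car := N\<rparr>)" by (rule fd_submodule[OF less.prems(1) N(1)])
      have "N \<noteq> car P" using N NP by (auto simp: submodule_def)
      thus "cdim (P\<lparr>car := N\<rparr>) < cdim P"
        using cdim_submodule[OF less.prems(1) N(1)] by fastforce
      obtain \<pi> where \<pi>: "\<pi> \<in> module_hom P (P\<lparr>car := N\<rparr>)" "(\<lambda>x. x - \<pi> x) \<in> module_hom P (P\<lparr>car := N'\<rparr>)"
        "\<And>x y. x \<in> N \<Longrightarrow> y \<in> N' \<Longrightarrow> \<pi> (x + y) = x"
        by (rule complement_projection[OF lm N(1-4)]) (rule that)
      show "projective (P\<lparr>car := N\<rparr>)"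
      proof (rule projective_retract[OF less.prems(2) fd_left_module[OF fd] _ \<pi>(1)])
        show "(\<lambda>x. x) \<in> module_hom (P\<lparr>car := N\<rparr>) P" using NP by (auto simp: module_hom_def)
        show "\<pi> x = x" if "x \<in> car (P\<lparr>car := N\<rparr>)" for x
          using \<pi>(3)[of x 0] that N(2) by (simp add: submodule_def)
      qed
    qed
    have "{x + y | x y. x \<in> N' \<and> y \<in> N} = {x + y | x y. x \<in> N \<and> y \<in> N'}"
    proof (intro Collect_cong iffI; elim exE conjE)
      fix z x y assume "z = x + y" "x \<in> N'" "y \<in> N"
      thus "\<exists>x y. z = x + y \<and> x \<in> N \<and> y \<in> N'"
        by (intro exI[of _ y] exI[of _ x]) (simp add: add.commute)
    next
      fix z x y assume "z = x + y" "x \<in> N" "y \<in> N'"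
      thus "\<exists>x y. z = x + y \<and> x \<in> N' \<and> y \<in> N"
        by (intro exI[of _ y] exI[of _ x]) (simp add: add.commute)
    qed
    hence swap: "{x + y | x y. x \<in> N' \<and> y \<in> N} = car P" using N(4) by simp
    obtain m where m: "\<forall>X. X \<notin> \<Q> \<longrightarrow> m X = 0" "isomorphic (P\<lparr>car := N\<rparr>) (dsum (copies \<Q> m) fst)"
      using summand[OF N(1-4) N(6)] by blast
    obtain m' where m': "\<forall>X. X \<notin> \<Q> \<longrightarrow> m' X = 0" "isomorphic (P\<lparr>car := N'\<rparr>) (dsum (copies \<Q> m') fst)"
      using summand[OF N(2,1) _ swap N(5)] N(3) by blast
    show ?thesis
      using isomorphic_copies_add[OF lm N(1-4) m(2) m'(2)] m(1) m'(1)
      by (intro exI[of _ "\<lambda>X. m X + m' X"]) auto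
  qed
qed


section \<open>Differential operators on generating series\<close>

text \<open>The laws of \<^const>\<open>cscale\<close> hold on the carrier only, so coefficients are tracked together with a set that
  contains their values.\<close>

definition values_in :: "'w set \<Rightarrow> ('t \<Rightarrow> 'w \<Rightarrow> 'w) \<Rightarrow> bool" where
  "values_in W f \<longleftrightarrow> (\<forall>t w. f t w \<in> W)"

lemma map_scale_map_scale:
  "left_module V \<Longrightarrow> values_in (car V) f \<Longrightarrow>
     map_scale V b (map_scale V c f) = map_scale V (b * c) f"
  by (simp add: map_scale_def values_in_def cscale_cscale fun_eq_iff)

lemma map_scale_0_right: "left_module V \<Longrightarrow> map_scale V c 0 = 0"
  by (simp add: map_scale_def cscale_zero_right fun_eq_iff)

lemma map_scale_eq_0_iff:
  assumes "left_module V" "values_in (car V) f"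
  shows "map_scale V c f = 0 \<longleftrightarrow> c = 0 \<or> f = 0"
  using assms by (auto simp: map_scale_def values_in_def cscale_eq_0_iff fun_eq_iff)

lemma sum_fun_apply2: "(\<Sum>i\<in>I. f i) t w = (\<Sum>i\<in>I. f i t w)"
  by (induction I rule: infinite_finite_induct) auto

lemma nth_sum_fps: "fps_nth (\<Sum>i\<in>I. F i) n = (\<Sum>i\<in>I. fps_nth (F i) n)"
  by (induction I rule: infinite_finite_induct) auto

lemma euler_op_power_nth:
  assumes V: "left_module V" and F: "values_in (car V) (fps_nth F n)"
  shows "fps_nth ((euler_op (map_scale V) ^^ i) F) n = map_scale V (of_nat n ^ i) (fps_nth F n)"
proof (induction i)
  case 0
  show ?case using F by (auto simp: map_scale_def cscale_one[OF V] values_in_def fun_eq_iff)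
next
  case (Suc i)
  thus ?case by (simp add: euler_op_def map_scale_map_scale[OF V F])
qed

lemma poly_euler_op_nth:
  assumes V: "left_module V" and F: "values_in (car V) (fps_nth F n)"
  shows "fps_nth (poly_euler_op (map_scale V) q F) n = map_scale V (poly q (of_nat n)) (fps_nth F n)"
proof -
  have "fps_nth (poly_euler_op (map_scale V) q F) n =
    (\<Sum>i\<le>degree q. map_scale V (coeff q i * of_nat n ^ i) (fps_nth F n))"
    by (simp add: poly_euler_op_def nth_sum_fps euler_op_power_nth[OF V F] map_scale_map_scale[OF V F])
  also have "\<dots> = map_scale V (poly q (of_nat n)) (fps_nth F n)"
    using F by (simp add: fun_eq_iff sum_fun_apply2 map_scale_def poly_altdef values_in_def
        cscale_sum_left[OF V])
  finally show ?thesis .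
qed

text \<open>For \<open>j < k\<close> the summand \<open>x\<^sup>j p\<^sub>j(x d/dx)\<close> would have to draw on the coefficient of degree
  \<open>m + k - j > m\<close>, which is \<open>0\<close>.\<close>

lemma diff_op_top_coeff:
  assumes V: "left_module V" and F: "\<And>n. values_in (car V) (fps_nth F n)"
    and top: "\<And>n. n > m \<Longrightarrow> fps_nth F n = 0"
  shows "fps_nth (diff_op (map_scale V) k p F) (m + k) =
    map_scale V (poly (p k) (of_nat m)) (fps_nth F m)"
proof -
  have "fps_nth (diff_op (map_scale V) k p F) (m + k) =
    (\<Sum>j\<le>k. map_scale V (poly (p j) (of_nat (m + k - j))) (fps_nth F (m + k - j)))"
    by (simp add: diff_op_def nth_sum_fps x_shift_def poly_euler_op_nth[OF V F])
  also have "\<dots> = (\<Sum>j\<le>k. if j = k then map_scale V (poly (p k) (of_nat m)) (fps_nth F m) else 0)"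
    using top by (intro sum.cong) (auto simp: map_scale_0_right[OF V])
  finally show ?thesis by simp
qed

lemma diff_op_degree_bound:
  assumes V: "left_module V" and F: "\<And>n. values_in (car V) (fps_nth F n)"
    and top: "\<And>n. n > m \<Longrightarrow> fps_nth F n = 0" and m: "fps_nth F m \<noteq> 0"
    and deg: "deg_x (diff_op (map_scale V) k p F) \<le> ereal (real s)"
  shows "real m \<le> real s - real k \<or> poly (p k) (of_nat m) = 0"
proof (cases "m + k \<le> s")
  case False
  have "fps_nth (diff_op (map_scale V) k p F) (m + k) = 0"
  proof (rule ccontr)
    assume "\<not> ?thesis"
    hence "ereal (real (m + k)) \<le> deg_x (diff_op (map_scale V) k p F)"
      unfolding deg_x_def by (intro Sup_upper) blast
    hence "ereal (real (m + k)) \<le> ereal (real s)" using deg by (rule order_trans)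
    thus False using False by simp
  qed
  thus ?thesis using m by (simp add: diff_op_top_coeff[OF V F top] map_scale_eq_0_iff[OF V F])
qed auto


section \<open>Embedded and linearised profiles detect zero modules\<close>

lemma PiN_left_module:
  assumes "fixed_embedding_system P E M' \<sigma>"
  shows "left_module (PiN P E)"
proof -
  have "fd_module (P v)" "fd_module (E v)" for v
    using assms by (simp_all add: fixed_embedding_system_def representatives_def)
  hence "left_module (P v)" "left_module (E v)" for v by (auto intro: fd_left_module)
  thus ?thesis unfolding PiN_def by (intro left_module_dsum left_module_dsum2)
qed

text \<open>A vector \<open>x\<close> of \<open>M\<close> is visible in the embedded profile at \<open>\<sigma>\<^sub>M\<^sup>-\<^sup>1 (x, 0)\<close>.\<close>

lemma
  fixes a :: "'d::finite \<Rightarrow> 'a::complex_algebra_1"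
  assumes a: "algebra_basis a" and sys: "fixed_embedding_system P E M' \<sigma>" and M: "in_CA M"
  shows Emb_profile_values_in: "values_in (car (PiN P E)) (Emb P E \<sigma> M (profile a M))"
    and Emb_profile_eq_0_iff: "Emb P E \<sigma> M (profile a M) = 0 \<longleftrightarrow> car M = {0}"
proof -
  let ?V = "PiN P E"
  note lmV = PiN_left_module[OF sys]
  have fd: "fd_module M" using M by (simp add: in_CA_def)
  note lm = fd_left_module[OF fd]
  have lmM': "left_module (M' M)" and \<sigma>: "\<sigma> M \<in> module_iso ?V (dsum2 M (M' M))"
    using sys M by (auto simp: fixed_embedding_system_def)
  have \<sigma>h: "\<sigma> M \<in> module_hom ?V (dsum2 M (M' M))" and inj: "inj_on (\<sigma> M) (car ?V)"
    and im: "\<sigma> M ` car ?V = car M \<times> car (M' M)"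
    using \<sigma> by (auto simp: module_iso_def bij_betw_def dsum2_def)
  have \<sigma>0: "\<sigma> M 0 = 0" by (rule hom_zero[OF lmV \<sigma>h])
  let ?inv = "inv_into (car ?V) (\<sigma> M)"
  have pair: "(x, 0) \<in> \<sigma> M ` car ?V" if "x \<in> car M" for x
    using that zero_in_car[OF lmM'] unfolding im by simp
  have inv_in: "?inv (x, 0) \<in> car ?V" if "x \<in> car M" for x
    by (rule inv_into_into[OF pair[OF that]])
  have inv_zero: "?inv (0, 0) = 0"
    by (rule inv_into_f_eq[OF inj zero_in_car[OF lmV]]) (simp add: \<sigma>0 zero_prod_def)
  have fst_in: "fst (\<sigma> M w) \<in> car M" if "w \<in> car ?V" for w
  proof -
    have "\<sigma> M w \<in> \<sigma> M ` car ?V" using that by (rule imageI)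
    thus ?thesis unfolding im by (rule mem_Times_iff[THEN iffD1, THEN conjunct1])
  qed
  show val: "values_in (car ?V) (Emb P E \<sigma> M (profile a M))"
    using inv_in fst_in zero_in_car[OF lmV] profile_in_car[OF a fd]
    by (simp add: values_in_def Emb_def)
  show "Emb P E \<sigma> M (profile a M) = 0 \<longleftrightarrow> car M = {0}"
  proof
    assume z: "car M = {0}"
    have "fst (\<sigma> M w) = 0" if "w \<in> car ?V" for w using fst_in[OF that] z by simp
    hence "Emb P E \<sigma> M (profile a M) t w = 0" for t w
      by (simp add: Emb_def profile_zero[OF a fd] inv_zero)
    thus "Emb P E \<sigma> M (profile a M) = 0" by (intro ext) simp
  next
    assume z: "Emb P E \<sigma> M (profile a M) = 0"
    have "x = 0" if x: "x \<in> car M" for x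
    proof (rule ccontr)
      assume "x \<noteq> 0"
      then obtain t where t: "profile a M t x \<noteq> 0" using profile_nonzero[OF a fd x] by blast
      have px: "profile a M t x \<in> car M" by (rule profile_in_car[OF a fd x])
      have "Emb P E \<sigma> M (profile a M) t (?inv (x, 0)) = ?inv (profile a M t x, 0)"
        using inv_in[OF x] f_inv_into_f[OF pair[OF x]] by (simp add: Emb_def)
      hence "?inv (profile a M t x, 0) = 0" using z by simp
      hence "(profile a M t x, 0) = \<sigma> M 0" using f_inv_into_f[OF pair[OF px]] by simp
      thus False using t \<sigma>0 by (simp add: zero_prod_def)
    qed
    thus "car M = {0}" using zero_in_car[OF lm] by blast
  qed
qed

lemma internal_direct_sum_component:
  assumes ds: "internal_direct_sum V J C"
  shows "w \<in> car V \<Longrightarrow> j \<in> J \<Longrightarrow> component J C w j \<in> C j"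
    and "left_module V \<Longrightarrow> i \<in> J \<Longrightarrow> w \<in> C i \<Longrightarrow> component J C w = (\<lambda>j. if j = i then w else 0)"
proof -
  have ex1: "\<exists>!x. is_decomposition J C w x" if "w \<in> car V" for w
    using ds that by (simp add: internal_direct_sum_def)
  show "component J C w j \<in> C j" if "w \<in> car V" "j \<in> J" for w j
    using theI'[OF ex1[OF that(1)]] that(2) by (simp add: component_def is_decomposition_def)
  assume V: "left_module V" and i: "i \<in> J" and w: "w \<in> C i"
  have sub: "submodule V (C j)" if "j \<in> J" for j
    using ds that by (simp add: internal_direct_sum_def)
  have wV: "w \<in> car V" using sub[OF i] w by (auto simp: submodule_def)
  have "is_decomposition J C w (\<lambda>j. if j = i then w else 0)"
  proof -
    have "{j. (if j = i then w else 0) \<noteq> 0} = (if w = 0 then {} else {i})" by auto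
    thus ?thesis
      using i w sub by (auto simp: is_decomposition_def submodule_def)
  qed
  thus "component J C w = (\<lambda>j. if j = i then w else 0)"
    unfolding component_def by (rule the1_equality[OF ex1[OF wV]])
qed

text \<open>The sum that defines \<^const>\<open>lin_profile\<close> ranges over the projective members of \<open>\<X>\<close>, and a sum over an
  infinite set is \<open>0\<close> by convention. It is finite because these members are pairwise nonisomorphic
  and each is isomorphic to some \<open>P v\<close>, with \<open>v\<close> in a finite type.\<close>

lemma
  assumes sys: "fixed_embedding_system P E M' \<sigma>" and comp: "compatible_orthogonal P E M' \<sigma> \<X> C"
  shows finite_projectives: "finite {X \<in> \<X>. projective X}"
    and projectives_cover: "fd_module X \<Longrightarrow> indecomposable X \<Longrightarrow> projective X \<Longrightarrow>
      \<exists>Y\<in>{X \<in> \<X>. projective X}. isomorphic X Y"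
proof -
  have rep: "X \<in> \<X> \<Longrightarrow> in_CA X \<and> indecomposable X"
    and uniq: "in_CA X \<Longrightarrow> indecomposable X \<Longrightarrow> \<exists>!Y. Y \<in> \<X> \<and> isomorphic X Y" for X
    using comp by (auto simp: compatible_orthogonal_def representatives_def)
  have Prep: "fd_module (P v) \<and> indecomposable (P v) \<and> projective (P v)" for v
    using sys by (simp add: fixed_embedding_system_def representatives_def)
  have Pcov: "\<exists>v. isomorphic X (P v)" if "fd_module X" "indecomposable X" "projective X" for X
    using sys that by (auto simp: fixed_embedding_system_def representatives_def)
  have "{X \<in> \<X>. projective X} \<subseteq> range (\<lambda>v. THE Y. Y \<in> \<X> \<and> isomorphic (P v) Y)"
  proof
    fix X assume X: "X \<in> {X \<in> \<X>. projective X}"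
    hence fd: "fd_module X" using rep by (auto simp: in_CA_def)
    then obtain v where v: "isomorphic X (P v)" using Pcov X rep by blast
    have "isomorphic (P v) X" by (rule isomorphic_sym[OF fd_left_module[OF fd] v])
    moreover have "\<exists>!Y. Y \<in> \<X> \<and> isomorphic (P v) Y"
      using Prep[of v] by (intro uniq) (auto intro: projective_in_CA)
    ultimately have "(THE Y. Y \<in> \<X> \<and> isomorphic (P v) Y) = X"
      using X by (intro the1_equality) auto
    thus "X \<in> range (\<lambda>v. THE Y. Y \<in> \<X> \<and> isomorphic (P v) Y)" by blast
  qed
  thus "finite {X \<in> \<X>. projective X}" by (rule finite_subset) simp
  assume X: "fd_module X" "indecomposable X" "projective X"
  then obtain Y where Y: "Y \<in> \<X>" "isomorphic X Y"
    using uniq[OF projective_in_CA] by blast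
  have "left_module Y" using rep[OF Y(1)] by (auto simp: in_CA_def intro: fd_left_module)
  hence "projective Y" using projective_iso[OF X(3)] Y(2) by (auto simp: isomorphic_def)
  thus "\<exists>Y\<in>{X \<in> \<X>. projective X}. isomorphic X Y" using Y by blast
qed

text \<open>The multiplicities are a choice among all solutions of an isomorphism condition;
  \<open>projective_decomposition\<close> provides a solution, so the chosen one satisfies the condition too.\<close>

lemma proj_mult_eq_0_iff:
  assumes sys: "fixed_embedding_system P E M' \<sigma>" and comp: "compatible_orthogonal P E M' \<sigma> \<X> C"
    and N: "fd_module N" "projective N"
  shows "(\<forall>Q\<in>{X \<in> \<X>. projective X}. proj_mult \<X> N Q = 0) \<longleftrightarrow> car N = {0}"
proof -
  let ?Q = "{X \<in> \<X>. projective X}" and ?m = "proj_mult \<X> N"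
  have "\<exists>m. (\<forall>X. X \<notin> ?Q \<longrightarrow> m X = 0) \<and> isomorphic N (dsum (copies ?Q m) fst)"
    by (rule projective_decomposition[OF projectives_cover[OF sys comp] N])
  hence m: "(\<forall>X. X \<notin> ?Q \<longrightarrow> ?m X = 0) \<and> isomorphic N (dsum (copies ?Q ?m) fst)"
    unfolding proj_mult_def by (rule someI_ex)
  have rep: "in_CA X \<and> indecomposable X" if "X \<in> \<X>" for X
    using comp that by (auto simp: compatible_orthogonal_def representatives_def)
  have lmQ: "left_module X" if "X \<in> \<X>" for X
    using rep[OF that] by (auto simp: in_CA_def intro: fd_left_module)
  have "left_module (dsum (copies ?Q ?m) fst)"
    using lmQ by (intro left_module_dsum) (auto simp: copies_def)
  hence iff: "car N = {0} \<longleftrightarrow> car (dsum (copies ?Q ?m) fst) = {0}"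
    using m by (intro isomorphic_zero_iff[OF fd_left_module[OF N(1)]] conjunct2[OF m])
  show ?thesis
  proof
    assume "\<forall>Q\<in>?Q. ?m Q = 0"
    hence "copies ?Q ?m = {}" by (auto simp: copies_def)
    thus "car N = {0}" unfolding iff by (auto simp: dsum_def fun_eq_iff)
  next
    assume z: "car N = {0}"
    show "\<forall>Q\<in>?Q. ?m Q = 0"
    proof (rule ccontr)
      assume "\<not> ?thesis"
      then obtain Q where Q: "Q \<in> ?Q" "?m Q \<noteq> 0" by blast
      have "car Q \<noteq> {0}" using Q rep by (auto simp: indecomposable_def)
      then obtain x where x: "x \<in> car Q" "x \<noteq> 0" using zero_in_car[OF lmQ] Q by blast
      define y where "y = (\<lambda>i. if i = (Q, 1::nat) then x else 0)"
      have "{i. y i \<noteq> 0} \<subseteq> {(Q, 1)}" by (auto simp: y_def)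
      hence "finite {i. y i \<noteq> 0}" by (rule finite_subset) simp
      moreover have "(Q, 1) \<in> copies ?Q ?m" using Q by (simp add: copies_def)
      ultimately have "y \<in> car (dsum (copies ?Q ?m) fst)"
        using x zero_in_car[OF lmQ] by (auto simp: dsum_def y_def copies_def)
      hence "y = 0" using iff z by simp
      hence "y (Q, 1) = 0" by simp
      thus False using x by (simp add: y_def)
    qed
  qed
qed

text \<open>The summands cannot cancel: at a vector of the first copy of \<open>Q\<close> the components in all other copies
  are \<open>0\<close>, so only \<open>m\<^sub>Q\<close> times the profile of that copy remains, and \<open>m\<^sub>Q \<noteq> 0\<close> in characteristic
  \<open>0\<close>.\<close>

lemma
  fixes a :: "'d::finite \<Rightarrow> 'a::complex_algebra_1"
  assumes a: "algebra_basis a" and sys: "fixed_embedding_system P E M' \<sigma>"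
    and comp: "compatible_orthogonal P E M' \<sigma> \<X> C"
    and N: "fd_module N" "projective N"
  shows lin_profile_values_in: "values_in (car (PiN P E)) (lin_profile a P E \<X> C N)"
    and lin_profile_eq_0_iff: "lin_profile a P E \<X> C N = 0 \<longleftrightarrow> car N = {0}"
proof -
  let ?V = "PiN P E" and ?Q = "{X \<in> \<X>. projective X}" and ?m = "proj_mult \<X> N"
  let ?J = "all_copies \<X>"
  note lmV = PiN_left_module[OF sys]
  have rep: "in_CA X \<and> indecomposable X" if "X \<in> \<X>" for X
    using comp that by (auto simp: compatible_orthogonal_def representatives_def)
  have ds: "internal_direct_sum ?V ?J C"
    and isoC: "\<And>X r. (X, r) \<in> ?J \<Longrightarrow> isomorphic X (?V\<lparr>car := C (X, r)\<rparr>)"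
    using comp by (auto simp: compatible_orthogonal_def)
  note component = internal_direct_sum_component[OF ds]
  have J: "(Q, 1) \<in> ?J" if "Q \<in> ?Q" for Q using that by (simp add: all_copies_def)
  have sub: "submodule ?V (C j)" if "j \<in> ?J" for j
    using ds that by (simp add: internal_direct_sum_def)
  have fdC: "fd_module (?V\<lparr>car := C (Q, 1)\<rparr>)" if Q: "Q \<in> ?Q" for Q
  proof -
    have "fd_module Q" using rep Q by (auto simp: in_CA_def)
    thus ?thesis
      using fd_module_iso[OF _ submodule_left_module[OF lmV sub[OF J[OF Q]]]] isoC[OF J[OF Q]]
      by (auto simp: isomorphic_def)
  qed
  have cp_in: "copy_profile a P E \<X> C Q 1 t w \<in> car ?V" if Q: "Q \<in> ?Q" for Q t w
  proof -
    have "profile a (?V\<lparr>car := C (Q, 1)\<rparr>) t x \<in> C (Q, 1)" if "x \<in> C (Q, 1)" for x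
      using profile_in_car[OF a fdC[OF Q], of x t] that by simp
    moreover have "C (Q, 1) \<subseteq> car ?V" using sub[OF J[OF Q]] by (simp add: submodule_def)
    ultimately show ?thesis
      using component(1)[OF _ J[OF Q]] zero_in_car[OF lmV]
      by (auto simp: copy_profile_def simp del: One_nat_def)
  qed
  have lin: "lin_profile a P E \<X> C N t w =
      (\<Sum>Q\<in>?Q. cscale ?V (of_nat (?m Q)) (copy_profile a P E \<X> C Q 1 t w))" for t w
    by (simp add: lin_profile_def sum_fun_apply2 map_scale_def)
  show "values_in (car ?V) (lin_profile a P E \<X> C N)"
    unfolding values_in_def lin using cp_in by (intro allI sum_in_car[OF lmV] cscale_in_car[OF lmV])
  show "lin_profile a P E \<X> C N = 0 \<longleftrightarrow> car N = {0}"
  proof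
    assume "car N = {0}"
    hence "?m Q = 0" if "Q \<in> ?Q" for Q using proj_mult_eq_0_iff[OF sys comp N] that by blast
    thus "lin_profile a P E \<X> C N = 0"
      using cp_in by (auto simp: fun_eq_iff lin cscale_zero_left[OF lmV] intro!: sum.neutral)
  next
    assume z: "lin_profile a P E \<X> C N = 0"
    show "car N = {0}"
    proof (rule ccontr)
      assume "car N \<noteq> {0}"
      then obtain Q where Q: "Q \<in> ?Q" "?m Q \<noteq> 0" using proj_mult_eq_0_iff[OF sys comp N] by blast
      have "in_CA Q" "indecomposable Q" using rep Q by auto
      hence "car Q \<noteq> {0}" "left_module Q"
        by (auto simp: indecomposable_def in_CA_def intro: fd_left_module)
      hence "C (Q, 1) \<noteq> {0}"
        using isomorphic_zero_iff[OF _ fd_left_module[OF fdC[OF Q(1)]] isoC[OF J[OF Q(1)]]] by simp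
      then obtain w where w: "w \<in> C (Q, 1)" "w \<noteq> 0"
        using sub[OF J[OF Q(1)]] by (auto simp: submodule_def)
      hence wV: "w \<in> car ?V" using sub[OF J[OF Q(1)]] by (auto simp: submodule_def)
      obtain t where t: "profile a (?V\<lparr>car := C (Q, 1)\<rparr>) t w \<noteq> 0"
        using profile_nonzero[OF a fdC[OF Q(1)]] w by auto
      have cw: "component ?J C w = (\<lambda>j. if j = (Q, 1) then w else 0)"
        by (rule component(2)[OF lmV J[OF Q(1)] w(1)])
      have "copy_profile a P E \<X> C X 1 t w =
          (if X = Q then profile a (?V\<lparr>car := C (Q, 1)\<rparr>) t w else 0)" if "X \<in> ?Q" for X
        using wV profile_zero[OF a fdC[OF that]] by (simp add: copy_profile_def cw del: One_nat_def)
      hence "lin_profile a P E \<X> C N t w = (\<Sum>X\<in>?Q. if X = Q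
          then cscale ?V (of_nat (?m Q)) (profile a (?V\<lparr>car := C (Q, 1)\<rparr>) t w) else 0)"
        unfolding lin by (intro sum.cong) (auto simp: cscale_zero_right[OF lmV])
      also have "\<dots> = cscale ?V (of_nat (?m Q)) (profile a (?V\<lparr>car := C (Q, 1)\<rparr>) t w)"
        using Q(1) finite_projectives[OF sys comp] by (simp only: sum.delta if_True)
      finally have eq: "cscale ?V (of_nat (?m Q)) (profile a (?V\<lparr>car := C (Q, 1)\<rparr>) t w) = 0"
        using z by simp
      have "profile a (?V\<lparr>car := C (Q, 1)\<rparr>) t w \<in> C (Q, 1)"
        using profile_in_car[OF a fdC[OF Q(1)], of w t] w(1) by simp
      hence "profile a (?V\<lparr>car := C (Q, 1)\<rparr>) t w \<in> car ?V"
        using sub[OF J[OF Q(1)]] by (auto simp: submodule_def)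
      thus False using eq Q(2) t by (simp add: cscale_eq_0_iff[OF lmV])
    qed
  qed
qed


section \<open>The bound for the finitistic dimension\<close>

lemma findim_le:
  assumes "\<And>M :: 'a::complex_algebra_1 amod. \<And>m. fd_module M \<Longrightarrow> proj_dim M = enat m \<Longrightarrow> ereal (real m) \<le> b"
    and "0 \<le> b"
  shows "ereal_of_enat (findim TYPE('a)) \<le> b"
proof -
  let ?A = "{proj_dim M | M :: 'a amod. fd_module M \<and> proj_dim M < \<infinity>}"
  have le: "ereal_of_enat x \<le> b" if "x \<in> ?A" for x
    using that assms(1) by (cases x) auto
  show ?thesis
  proof (cases "?A = {}")
    case True
    \<comment> \<open>in \<open>enat\<close>, the supremum of the empty set is \<open>0\<close>\<close>
    have "findim TYPE('a) = Sup {}" unfolding findim_def True ..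
    thus ?thesis using assms(2) by (simp add: bot_enat_def)
  next
    case False
    have "ereal_of_enat (Sup ?A) \<le> b"
      unfolding ereal_of_enat_Sup[OF False] using le by (rule SUP_least)
    thus ?thesis by (simp only: findim_def)
  qed
qed

theorem theorem8:
  fixes a :: "'d::finite \<Rightarrow> 'a::complex_algebra_1"
    and P E :: "'v::finite \<Rightarrow> 'a amod"
    and M' :: "'a amod \<Rightarrow> 'a amod"
    and \<sigma> :: "'a amod \<Rightarrow> 'v pin \<Rightarrow> univ \<times> univ"
    and \<X> :: "'a amod set"
    and C :: "'a amod \<times> nat \<Rightarrow> 'v pin set"
    and k s :: nat
    and p :: "nat \<Rightarrow> complex poly"
  defines "S \<equiv> {0, ereal (real s - real k)} \<union> {ereal (real n) | n. poly (p k) (of_nat n) = 0}"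
  assumes "algebra_basis a"
    and "fixed_embedding_system P E M' \<sigma>"
    and "compatible_orthogonal P E M' \<sigma> \<X> C"
    and "p k \<noteq> 0"
    and "(\<forall>M N d e. fd_module M \<and> car M \<noteq> {0} \<and> minimal_projective_resolution M N d e \<longrightarrow>
            (let R = diff_op (map_scale (PiN P E)) k p (emb_series a P E \<sigma> N)
             in R \<in> poly_over (coeff_ring a P E \<sigma>) \<and> deg_x R \<le> ereal (real s)))
       \<or> (\<forall>M N d e. fd_module M \<and> car M \<noteq> {0} \<and> minimal_projective_resolution M N d e \<longrightarrow>
            (let R = diff_op (map_scale (PiN P E)) k p (lin_series a P E \<X> C N)
             in R \<in> poly_over (coeff_ring a P E \<sigma>) \<and> deg_x R \<le> ereal (real s)))"
  shows "finite S \<and> ereal_of_enat (findim TYPE('a)) \<le> Max S \<and> Max S < \<infinity>"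
proof -
  note a = assms(2) and sys = assms(3) and comp = assms(4)
  let ?V = "PiN P E"
  note lmV = PiN_left_module[OF sys]
  \<comment> \<open>the common part of both alternatives: coefficients with values in \<open>?V\<close> that detect zero modules\<close>
  obtain G :: "(nat \<Rightarrow> 'a amod) \<Rightarrow> ('d orthant \<Rightarrow> 'v pin \<Rightarrow> 'v pin) fps"
    where G: "\<And>N n. fd_module (N n) \<Longrightarrow> projective (N n) \<Longrightarrow>
        values_in (car ?V) (fps_nth (G N) n) \<and> (fps_nth (G N) n = 0 \<longleftrightarrow> car (N n) = {0})"
    and deg: "\<And>M N d e. fd_module M \<Longrightarrow> car M \<noteq> {0} \<Longrightarrow> minimal_projective_resolution M N d e \<Longrightarrow>
        deg_x (diff_op (map_scale ?V) k p (G N)) \<le> ereal (real s)"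
    using assms(6)
  proof (elim disjE)
    assume emb: "\<forall>M N d e. fd_module M \<and> car M \<noteq> {0} \<and> minimal_projective_resolution M N d e \<longrightarrow>
            (let R = diff_op (map_scale (PiN P E)) k p (emb_series a P E \<sigma> N)
             in R \<in> poly_over (coeff_ring a P E \<sigma>) \<and> deg_x R \<le> ereal (real s))"
    show thesis
      by (rule that[of "emb_series a P E \<sigma>"])
        (use emb in \<open>auto simp: Let_def emb_series_def Emb_profile_values_in[OF a sys projective_in_CA]
          Emb_profile_eq_0_iff[OF a sys projective_in_CA]\<close>)
  next
    assume lin: "\<forall>M N d e. fd_module M \<and> car M \<noteq> {0} \<and> minimal_projective_resolution M N d e \<longrightarrow>
            (let R = diff_op (map_scale (PiN P E)) k p (lin_series a P E \<X> C N)
             in R \<in> poly_over (coeff_ring a P E \<sigma>) \<and> deg_x R \<le> ereal (real s))"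
    show thesis
      by (rule that[of "lin_series a P E \<X> C"])
        (use lin in \<open>auto simp: Let_def lin_series_def lin_profile_values_in[OF a sys comp]
          lin_profile_eq_0_iff[OF a sys comp]\<close>)
  qed
  have bound: "real m \<le> real s - real k \<or> poly (p k) (of_nat m) = 0"
    if M: "fd_module M" "proj_dim M = enat m" and m: "m > 0" for M :: "'a amod" and m
  proof -
    have "car M \<noteq> {0}"
      using proj_dim_zero_module[OF fd_left_module[OF M(1)]] M(2) m by (auto simp: zero_enat_def)
    obtain N d e where N: "minimal_projective_resolution M N d e"
      using exists_minimal_projective_resolution[OF a M(1)] by blast
    have fdN: "fd_module (N n)" "projective (N n)" for n
      using N by (auto simp: minimal_projective_resolution_def projective_resolution_def)
    note top = minimal_resolution_top[OF M(1) N M(2) m]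
    show ?thesis
      using G[OF fdN] top
      by (intro diff_op_degree_bound[OF lmV _ _ _ deg[OF M(1) \<open>car M \<noteq> {0}\<close> N]]) auto
  qed
  have "finite {n :: nat. poly (p k) (of_nat n) = 0}"
  proof -
    have "finite ((of_nat :: nat \<Rightarrow> complex) -` {z. poly (p k) z = 0})"
      by (rule finite_vimageI[OF poly_roots_finite[OF assms(5)]]) (simp add: inj_on_def)
    thus ?thesis by (simp add: vimage_def)
  qed
  hence fin: "finite S" by (simp add: S_def)
  have upper: "x \<le> Max S" if "x \<in> S" for x using fin that by (rule Max_ge)
  have "Max S \<in> S" by (rule Max_in[OF fin]) (simp add: S_def)
  hence "Max S < \<infinity>" by (auto simp: S_def)
  moreover have "ereal_of_enat (findim TYPE('a)) \<le> Max S"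
  proof (rule findim_le)
    show "0 \<le> Max S" by (rule upper) (simp add: S_def)
    fix M :: "'a amod" and m assume M: "fd_module M" "proj_dim M = enat m"
    show "ereal (real m) \<le> Max S"
    proof (cases "m = 0")
      case True
      thus ?thesis using \<open>0 \<le> Max S\<close> by (simp add: zero_ereal_def)
    next
      case False
      hence "real m \<le> real s - real k \<or> poly (p k) (of_nat m) = 0" using bound[OF M] by simp
      thus ?thesis
      proof
        assume "real m \<le> real s - real k"
        hence "ereal (real m) \<le> ereal (real s - real k)" by simp
        also have "\<dots> \<le> Max S" by (rule upper) (simp add: S_def)
        finally show ?thesis .
      next
        assume "poly (p k) (of_nat m) = 0"
        thus ?thesis by (intro upper) (auto simp: S_def)
      qed
    qed
  qed
  ultimately show ?thesis using fin by blast
qed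

end
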